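(* Let $\mu$, $L$ be as in the context. Suppose there is $r_0\in[0,\infty)$ such that the essential spectrum of $-L$ (as a self-adjoint operator on $L^2(\mu)$) is contained in $[1/r_0,\infty)$, where for $r_0=0$ this is understood as: $-L$ has empty essential spectrum. Then $\mu$ satisfies a partial super Poincaré inequality valid for all $r>8r_0$: there is a function $\beta:(8r_0,\infty)\to[0,\infty)$ such that for every $r>8r_0$ and every admissible $f$, \[\int f^2\,d\mu\le r\int|\nabla f|^2\,d\mu+\beta(r)\Big(\int|f|\,d\mu\Big)^2.\] In particular, if the essential spectrum of $-L$ is empty, the full super Poincaré inequality holds (for all $r>0$).
   Context: Setting: $n\ge1$, $V:\mathbb R^n\to\mathbb R$ is smooth with $\int e^{-V}dx<\infty$, and $\mu(dx)=Z^{-1}e^{-V(x)}dx$ is the associated probability measure. $L f=\Delta f-\nabla V\cdot\nabla f$, which is (the Friedrichs extension of) a nonnegative-definite self-adjoint operator $-L$ on $L^2(\mu)$ with Dirichlet form $D(f,f)=\int f(-Lf)\,d\mu=\int|\nabla f|^2d\mu$. "Admissible $f$" means $f$ in the domain of this Dirichlet form (e.g. locally Lipschitz $f\in L^2(\mu)$ with $\int|\nabla f|^2d\mu<\infty$). A (partial) super Poincaré inequality for $r>r_0$ means: for every $r>r_0$ there is $\beta(r)<\infty$ with $\int f^2d\mu\le r\int|\nabla f|^2d\mu+\beta(r)(\int|f|d\mu)^2$ for all admissible $f$; the full SPI is the case $r_0=0$. *)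

theory Defs
  imports "HOL-Analysis.Analysis"
begin

definition partial :: "'n::finite \<Rightarrow> (real^'n \<Rightarrow> real) \<Rightarrow> real^'n \<Rightarrow> real" where
  "partial i f x = deriv (\<lambda>t. f (x + t *\<^sub>R axis i 1)) 0"

definition iter_partial :: "'n::finite list \<Rightarrow> (real^'n \<Rightarrow> real) \<Rightarrow> real^'n \<Rightarrow> real" where
  "iter_partial is f = foldr partial is f"

definition smooth_fun :: "(real^'n::finite \<Rightarrow> real) \<Rightarrow> bool" where
  "smooth_fun f \<longleftrightarrow>
     (\<forall>is. continuous_on UNIV (iter_partial is f) \<and>
           (\<forall>i x. (\<lambda>t. iter_partial is f (x + t *\<^sub>R axis i 1)) differentiable (at 0)))"

definition test_fun :: "(real^'n::finite \<Rightarrow> real) \<Rightarrow> bool" where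
  "test_fun f \<longleftrightarrow> smooth_fun f \<and> compact (closure {x. f x \<noteq> 0})"

definition grad :: "(real^'n::finite \<Rightarrow> real) \<Rightarrow> real^'n \<Rightarrow> real^'n" where
  "grad f x = (\<chi> i. partial i f x)"

definition laplacian :: "(real^'n::finite \<Rightarrow> real) \<Rightarrow> real^'n \<Rightarrow> real" where
  "laplacian f x = (\<Sum>i\<in>UNIV. partial i (partial i f) x)"

definition genL :: "(real^'n::finite \<Rightarrow> real) \<Rightarrow> (real^'n \<Rightarrow> real) \<Rightarrow> real^'n \<Rightarrow> real" where
  "genL V f x = laplacian f x - grad V x \<bullet> grad f x"

definition Zc :: "(real^'n::finite \<Rightarrow> real) \<Rightarrow> real" where
  "Zc V = (\<integral>x. exp (- V x) \<partial>lborel)"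

definition mu :: "(real^'n::finite \<Rightarrow> real) \<Rightarrow> (real^'n) measure" where
  "mu V = density lborel (\<lambda>x. ennreal (exp (- V x) / Zc V))"

definition form_approx :: "(real^'n::finite \<Rightarrow> real) \<Rightarrow> (real^'n \<Rightarrow> real) \<Rightarrow> (nat \<Rightarrow> real^'n \<Rightarrow> real) \<Rightarrow> bool" where
  "form_approx V f \<phi> \<longleftrightarrow>
     (\<forall>k. test_fun (\<phi> k)) \<and>
     ((\<lambda>k. \<integral>x. (\<phi> k x - f x)^2 \<partial>mu V) \<longlonglongrightarrow> 0) \<and>
     (\<forall>e>0. \<exists>N. \<forall>k\<ge>N. \<forall>m\<ge>N. (\<integral>x. (norm (grad (\<phi> k) x - grad (\<phi> m) x))^2 \<partial>mu V) < e)"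

definition L2mu :: "(real^'n::finite \<Rightarrow> real) \<Rightarrow> (real^'n \<Rightarrow> real) \<Rightarrow> bool" where
  "L2mu V f \<longleftrightarrow> f \<in> borel_measurable lborel \<and> integrable (mu V) (\<lambda>x. (f x)^2)"

text \<open>Domain of the closed Dirichlet form (closure of the form on test functions).\<close>
definition form_dom :: "(real^'n::finite \<Rightarrow> real) \<Rightarrow> (real^'n \<Rightarrow> real) \<Rightarrow> bool" where
  "form_dom V f \<longleftrightarrow> L2mu V f \<and> (\<exists>\<phi>. form_approx V f \<phi>)"

text \<open>Graph of the Friedrichs extension A of -L: f in D(A) and A f = g.\<close>
definition friedrichs_graph :: "(real^'n::finite \<Rightarrow> real) \<Rightarrow> (real^'n \<Rightarrow> real) \<Rightarrow> (real^'n \<Rightarrow> real) \<Rightarrow> bool" where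
  "friedrichs_graph V f g \<longleftrightarrow> form_dom V f \<and> L2mu V g \<and>
     (\<forall>\<phi>. form_approx V f \<phi> \<longrightarrow> (\<forall>\<psi>. test_fun \<psi> \<longrightarrow>
        (\<lambda>k. \<integral>x. grad (\<phi> k) x \<bullet> grad \<psi> x \<partial>mu V) \<longlonglongrightarrow> (\<integral>x. g x * \<psi> x \<partial>mu V)))"

text \<open>Essential spectrum of the Friedrichs extension of -L (Weyl's criterion:
  existence of a singular Weyl sequence).\<close>
definition ess_spec :: "(real^'n::finite \<Rightarrow> real) \<Rightarrow> real set" where
  "ess_spec V = {lam. \<exists>f g. (\<forall>k. friedrichs_graph V (f k) (g k)) \<and>
       (\<forall>k. (\<integral>x. (f k x)^2 \<partial>mu V) = 1) \<and>
       (\<forall>h. L2mu V h \<longrightarrow> (\<lambda>k. \<integral>x. f k x * h x \<partial>mu V) \<longlonglongrightarrow> 0) \<and>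
       ((\<lambda>k. \<integral>x. (g k x - lam * f k x)^2 \<partial>mu V) \<longlonglongrightarrow> 0)}"

end

theory Submission
  imports Defs "HOL-Library.Function_Algebras"
begin

text \<open>If the inequality fails for some \<open>r\<close>, its violators, normalised in \<open>L\<^sup>2\<close>, tend to zero in \<open>L\<^sup>1\<close>,
  hence weakly in \<open>L\<^sup>2\<close>, while their energy stays below \<open>1 / r\<close>. For the resolvent
  \<open>T = (1 - L)\<^sup>-\<^sup>1\<close> this means that \<open>\<langle>T f, f\<rangle>\<close> stays above \<open>1 / (1 + 1 / r)\<close> along a weakly null sequence of
  unit vectors. The largest value \<open>c\<close> that \<open>\<langle>T f, f\<rangle>\<close> attains in the limit on weakly null sequences of
  the unit ball is an approximate eigenvalue: \<open>c - T\<close> is asymptotically nonnegative on such sequences, so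
  a maximising sequence \<open>f\<close> satisfies \<open>(c - T) f \<longlonglongrightarrow> 0\<close>. Thus \<open>T f\<close>, normalised, is a singular Weyl
  sequence for \<open>1 / c - 1 \<le> 1 / r\<close>, which lies below \<open>1 / r0\<close>.\<close>

section \<open>Semi-inner products and weakly null sequences\<close>

text \<open>A violator lies only in the form domain, where applying -L to it need not make sense, so
  Weyl's criterion cannot be tested on it directly; the resolvent acts on all of L^2 and converts
  low energy into a large value of its quadratic form. Functions are not identified up to null sets,
  so the abstract part works with semi-inner products on a carrier subspace, and the resolvent is
  only a choice of representatives. The completed form domain is never built: its elements appear as
  sequences in the core of test functions, and weak solutions come from the Dirichlet principle with
  near-minimisers. The Friedrichs graph quantifies over every approximating sequence; independence
  of that sequence is the closability of the form, obtained here from integration by parts against a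
  fixed test function. Weakly null sequences are produced by making each term almost orthogonal to
  its predecessors, so that only finitely many test vectors occur at a time.\<close>

lemma quadratic_nonneg_imp_discriminant:
  fixes p a s :: real
  assumes "s \<ge> 0" and nn: "\<And>t. 0 \<le> p + 2 * t * a + t\<^sup>2 * s"
  shows "a\<^sup>2 \<le> p * s"
proof (cases "s = 0")
  case True
  have "a = 0"
  proof (rule ccontr)
    assume "a \<noteq> 0"
    \<comment> \<open>With \<open>s = 0\<close> the quadratic is affine in \<open>t\<close>, and at
      this \<open>t\<close> it equals -1.\<close>
    then show False using nn[of "- (p + 1) / (2 * a)"] True by (simp add: field_simps)
  qed
  then show ?thesis using True by simp
next
  case False
  then have "s > 0" using assms(1) by simp
  have "0 \<le> s * (p + 2 * (- a / s) * a + (- a / s)\<^sup>2 * s)"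
    using nn[of "- a / s"] \<open>s > 0\<close> by (intro mult_nonneg_nonneg) auto
  also have "\<dots> = p * s - a\<^sup>2"
    using \<open>s > 0\<close> by (simp add: field_simps power2_eq_square)
  finally show ?thesis by simp
qed

text \<open>Only semidefinite, and on a carrier set: functions that differ on a null set are
  distinct vectors, and one locale has to cover both the L^2 pairing on square integrable functions
  and the Dirichlet form on test functions.\<close>

locale semi_inner_space =
  fixes S :: "'a::real_vector set" and b :: "'a \<Rightarrow> 'a \<Rightarrow> real"
  assumes subspace_S: "subspace S"
    and sym: "x \<in> S \<Longrightarrow> y \<in> S \<Longrightarrow> b x y = b y x"
    and add_left: "x \<in> S \<Longrightarrow> y \<in> S \<Longrightarrow> z \<in> S \<Longrightarrow> b (x + y) z = b x z + b y z"
    and scale_left: "x \<in> S \<Longrightarrow> y \<in> S \<Longrightarrow> b (r *\<^sub>R x) y = r * b x y"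
    and nonneg: "x \<in> S \<Longrightarrow> 0 \<le> b x x"
begin

lemma closed [simp, intro]:
  "x \<in> S \<Longrightarrow> y \<in> S \<Longrightarrow> x + y \<in> S"
  "x \<in> S \<Longrightarrow> y \<in> S \<Longrightarrow> x - y \<in> S"
  "x \<in> S \<Longrightarrow> r *\<^sub>R x \<in> S"
  "0 \<in> S"
  using subspace_S by (auto intro: subspace_add subspace_diff subspace_scale subspace_0)

lemma diff_left: "x \<in> S \<Longrightarrow> y \<in> S \<Longrightarrow> z \<in> S \<Longrightarrow> b (x - y) z = b x z - b y z"
  using add_left[of "x - y" y z] by simp

lemma add_right: "x \<in> S \<Longrightarrow> y \<in> S \<Longrightarrow> z \<in> S \<Longrightarrow> b z (x + y) = b z x + b z y"
  by (simp add: sym[of z] add_left)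

lemma diff_right: "x \<in> S \<Longrightarrow> y \<in> S \<Longrightarrow> z \<in> S \<Longrightarrow> b z (x - y) = b z x - b z y"
  by (simp add: sym[of z] diff_left)

lemma scale_right: "x \<in> S \<Longrightarrow> y \<in> S \<Longrightarrow> b x (r *\<^sub>R y) = r * b x y"
  by (simp add: sym[of x] scale_left)

lemmas bilinear = add_left diff_left scale_left add_right diff_right scale_right

lemma square_add_scale:
  "x \<in> S \<Longrightarrow> y \<in> S \<Longrightarrow> b (x + t *\<^sub>R y) (x + t *\<^sub>R y) = b x x + 2 * t * b x y + t\<^sup>2 * b y y"
  by (simp add: bilinear sym[of y x] power2_eq_square algebra_simps)

lemma square_diff:
  "x \<in> S \<Longrightarrow> y \<in> S \<Longrightarrow> b (x - y) (x - y) = b x x - 2 * b x y + b y y"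
  by (simp add: bilinear sym[of y x] algebra_simps)

lemma Cauchy_Schwarz:
  assumes "x \<in> S" "y \<in> S"
  shows "(b x y)\<^sup>2 \<le> b x x * b y y"
  using assms nonneg[of "x + t *\<^sub>R y" for t]
  by (intro quadratic_nonneg_imp_discriminant) (auto simp: nonneg square_add_scale)

lemma square_diff_le:
  assumes "x \<in> S" "y \<in> S"
  shows "b (x - y) (x - y) \<le> 2 * b x x + 2 * b y y"
  using nonneg[of "x + 1 *\<^sub>R y"] assms
  by (simp only: square_add_scale square_diff closed) simp

lemma abs_le_sqrt:
  assumes "x \<in> S" "y \<in> S"
  shows "\<bar>b x y\<bar> \<le> sqrt (b x x) * sqrt (b y y)"
  using Cauchy_Schwarz[OF assms] real_sqrt_le_mono by (fastforce simp: real_sqrt_mult)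

lemma tendsto_right:
  assumes "\<And>n. x n \<in> S" "y \<in> S" "h \<in> S" and lim: "(\<lambda>n. b (x n - y) (x n - y)) \<longlonglongrightarrow> 0"
  shows "(\<lambda>n. b h (x n)) \<longlonglongrightarrow> b h y"
proof (rule LIM_zero_cancel, rule tendsto_rabs_zero_cancel, rule tendsto_sandwich[OF _ _ tendsto_const])
  show "\<forall>\<^sub>F n in sequentially. 0 \<le> \<bar>b h (x n) - b h y\<bar>" by simp
  show "\<forall>\<^sub>F n in sequentially. \<bar>b h (x n) - b h y\<bar> \<le> sqrt (b h h) * sqrt (b (x n - y) (x n - y))"
    using abs_le_sqrt[of h "x n - y" for n] assms by (simp add: diff_right)
  have "(\<lambda>n. sqrt (b h h) * sqrt (b (x n - y) (x n - y))) \<longlonglongrightarrow> sqrt (b h h) * sqrt 0"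
    by (intro tendsto_intros lim)
  then show "(\<lambda>n. sqrt (b h h) * sqrt (b (x n - y) (x n - y))) \<longlonglongrightarrow> 0" by simp
qed

lemma tendsto_square:
  assumes "\<And>n. x n \<in> S" "y \<in> S" and lim: "(\<lambda>n. b (x n - y) (x n - y)) \<longlonglongrightarrow> 0"
  shows "(\<lambda>n. b (x n) (x n)) \<longlonglongrightarrow> b y y"
proof -
  have "(\<lambda>n. b (x n - y) (x n - y) + 2 * b y (x n) - b y y) \<longlonglongrightarrow> 0 + 2 * b y y - b y y"
    by (intro tendsto_intros lim tendsto_right assms)
  moreover have "b (x n - y) (x n - y) + 2 * b y (x n) - b y y = b (x n) (x n)" for n
    using assms by (simp add: square_diff sym[of "x n" y])
  ultimately show ?thesis by simp
qed

definition weakly_null :: "(nat \<Rightarrow> 'a) \<Rightarrow> bool" where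
  "weakly_null x \<longleftrightarrow> (\<forall>n. x n \<in> S) \<and> (\<forall>h\<in>S. (\<lambda>n. b (x n) h) \<longlonglongrightarrow> 0)"

text \<open>An almost orthogonal sequence still satisfies Bessel's inequality up to a constant.\<close>
lemma weakly_null_almost_orthogonal:
  assumes xS: "\<And>n. x n \<in> S" and norm: "\<And>n. b (x n) (x n) \<le> 1"
    and ao: "\<And>j n. j < n \<Longrightarrow> (real n + 1) * 2 ^ n * \<bar>b (x n) (x j)\<bar> \<le> 1"
  shows "weakly_null x"
  unfolding weakly_null_def
proof (intro conjI ballI allI xS)
  fix h assume h: "h \<in> S"
  define a where "a n = b (x n) h" for n
  \<comment> \<open>Partial Fourier sums, with the coefficients of an orthonormal family;
    \<open>cross\<close> and \<open>step\<close> control the error made by this pretence.\<close>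
  define s where "s N = (\<Sum>n<N. a n *\<^sub>R x n)" for N
  define K where "K = b h h"
  have K: "K \<ge> 0" using h by (simp add: K_def nonneg)
  have a2: "(a n)\<^sup>2 \<le> K" for n
  proof -
    have "(a n)\<^sup>2 \<le> b (x n) (x n) * K" using Cauchy_Schwarz xS h by (simp add: a_def K_def)
    also have "\<dots> \<le> 1 * K" by (intro mult_right_mono norm K)
    finally show ?thesis by simp
  qed
  have sS: "s N \<in> S" for N by (induction N) (auto simp: s_def xS)
  have bs: "b (x m) (s N) = (\<Sum>n<N. a n * b (x m) (x n))" for m N
  proof (induction N)
    case 0 then show ?case using scale_right[of "x m" "x m" 0] xS by (simp add: s_def)
  next
    case (Suc N)
    have "s (Suc N) = s N + a N *\<^sub>R x N" by (simp add: s_def)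
    then show ?case using Suc xS sS by (simp add: bilinear)
  qed
  \<comment> \<open>There are \<open>N\<close> products, each carrying
    \<open>1 / ((real N + 1) * 2 ^ N)\<close>: the factor \<open>real N + 1\<close> absorbs their
    number, and the power of two makes the errors summable over \<open>N\<close>.\<close>
  have cross: "\<bar>2 * a N * b (x N) (s N)\<bar> \<le> 2 * K * (1/2)^N" for N
  proof -
    have "\<bar>a N * b (x N) (s N)\<bar> = \<bar>\<Sum>n<N. a N * a n * b (x N) (x n)\<bar>"
      by (simp add: bs sum_distrib_left mult.assoc)
    also have "\<dots> \<le> (\<Sum>n<N. \<bar>a N * a n * b (x N) (x n)\<bar>)" by (rule sum_abs)
    also have "\<dots> \<le> (\<Sum>n<N. K * (1 / ((real N + 1) * 2 ^ N)))"
    proof (intro sum_mono)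
      fix n assume n: "n \<in> {..<N}"
      have "(a N * a n)\<^sup>2 \<le> K\<^sup>2"
        using mult_mono[OF a2[of N] a2[of n]] K by (simp add: power_mult_distrib power2_eq_square[of K])
      then have "\<bar>a N * a n\<bar> \<le> K" using K by (simp add: abs_le_square_iff[symmetric])
      moreover have "\<bar>b (x N) (x n)\<bar> \<le> 1 / ((real N + 1) * 2 ^ N)"
        using ao[of n N] n by (subst pos_le_divide_eq) (auto simp: mult.commute)
      ultimately show "\<bar>a N * a n * b (x N) (x n)\<bar> \<le> K * (1 / ((real N + 1) * 2 ^ N))"
        unfolding abs_mult[of "a N * a n"] using K by (intro mult_mono) auto
    qed
    also have "\<dots> = K * (1/2)^N * (real N / (real N + 1))" by (simp add: field_simps power_divide)
    also have "\<dots> \<le> K * (1/2)^N * 1" using K by (intro mult_left_mono) auto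
    finally show ?thesis by simp
  qed
  \<comment> \<open>Passing from \<open>N\<close> to \<open>Suc N\<close> changes the squared
    residual by \<open>- 2 * (a N)\<^sup>2 + (a N)\<^sup>2 * b (x N) (x N)\<close> plus the cross
    term; the norm bound makes the first two at most \<open>- (a N)\<^sup>2\<close>, as in Bessel's
    inequality.\<close>
  have step: "b (h - s N) (h - s N) + (\<Sum>n<N. (a n)\<^sup>2) \<le> K + 2 * K * (\<Sum>n<N. (1/2)^n)" for N
  proof (induction N)
    case 0 then show ?case by (simp add: s_def K_def)
  next
    case (Suc N)
    have "s (Suc N) = s N + a N *\<^sub>R x N" by (simp add: s_def)
    then have "h - s (Suc N) = (h - s N) + (- a N) *\<^sub>R x N" by simp
    then have "b (h - s (Suc N)) (h - s (Suc N)) =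
        b (h - s N) (h - s N) + 2 * (- a N) * b (h - s N) (x N) + (- a N)\<^sup>2 * b (x N) (x N)"
      using h xS sS by (simp only: square_add_scale closed)
    also have "b (h - s N) (x N) = a N - b (x N) (s N)"
      using h xS sS by (simp add: diff_left a_def sym[of "x N"])
    finally have "b (h - s (Suc N)) (h - s (Suc N)) = b (h - s N) (h - s N) - 2 * (a N)\<^sup>2
       + 2 * a N * b (x N) (s N) + (a N)\<^sup>2 * b (x N) (x N)"
      by (simp add: algebra_simps power2_eq_square)
    moreover have "(a N)\<^sup>2 * b (x N) (x N) \<le> (a N)\<^sup>2 * 1" by (intro mult_left_mono norm) auto
    ultimately show ?case using Suc cross[of N] by (simp add: algebra_simps)
  qed
  have "summable (\<lambda>n. (a n)\<^sup>2)"
  proof (rule summableI_nonneg_bounded)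
    fix N
    have "(\<Sum>n<N. (1/2::real)^n) \<le> 2"
      using sum_le_suminf[of "\<lambda>n. (1/2::real)^n" "{..<N}"] suminf_geometric[of "1/2::real"]
      by simp
    then have "2 * K * (\<Sum>n<N. (1/2::real)^n) \<le> 2 * K * 2" using K by (intro mult_left_mono) auto
    moreover have "0 \<le> b (h - s N) (h - s N)" using h sS by (intro nonneg) auto
    ultimately show "(\<Sum>n<N. (a n)\<^sup>2) \<le> 5 * K" using step[of N] by linarith
  qed simp
  then have "(\<lambda>n. (a n)\<^sup>2) \<longlonglongrightarrow> 0" by (rule summable_LIMSEQ_zero)
  then have "(\<lambda>n. sqrt ((a n)\<^sup>2)) \<longlonglongrightarrow> sqrt 0" by (intro tendsto_intros)
  then show "(\<lambda>n. b (x n) h) \<longlonglongrightarrow> 0" by (simp add: a_def tendsto_rabs_zero_iff)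
qed

end

section \<open>The top of the essential spectrum of a bounded positive operator\<close>

text \<open>An operator given by choosing representatives is linear only up to null vectors.
  Symmetry stands in for linearity: sums and multiples are moved to the other argument of
  \<open>ip\<close>.\<close>

locale bounded_positive_operator = semi_inner_space H ip
  for H :: "'a::real_vector set" and ip +
  fixes T :: "'a \<Rightarrow> 'a"
  assumes T_closed [simp]: "f \<in> H \<Longrightarrow> T f \<in> H"
    and T_sym: "f \<in> H \<Longrightarrow> g \<in> H \<Longrightarrow> ip (T f) g = ip f (T g)"
    and T_nonneg: "f \<in> H \<Longrightarrow> 0 \<le> ip f (T f)"
    and T_le: "f \<in> H \<Longrightarrow> ip f (T f) \<le> ip f f"
    and T_norm_le: "f \<in> H \<Longrightarrow> ip (T f) (T f) \<le> ip f f"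
begin

text \<open>The fixed tolerance \<open>1\<close> loses nothing, since the test vectors in \<open>G\<close> may be rescaled.\<close>
definition weak_nbhd :: "'a set \<Rightarrow> 'a set" where
  "weak_nbhd G = {f \<in> H. ip f f \<le> 1 \<and> (\<forall>g\<in>G. \<bar>ip f g\<bar> \<le> 1)}"

text \<open>Finite test sets instead of sequences: the negation hands over one single
  \<open>G\<close> valid for all vectors, and the positive statement can be applied to the finite
  history of a sequence under construction.\<close>

definition essential_level :: "real \<Rightarrow> bool" where
  "essential_level t \<longleftrightarrow> (\<forall>G. finite G \<longrightarrow> G \<subseteq> H \<longrightarrow> (\<exists>f\<in>weak_nbhd G. t \<le> ip f (T f)))"

lemma essential_level_le_1: "essential_level t \<Longrightarrow> t \<le> 1"
  unfolding essential_level_def weak_nbhd_def using T_le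
  by (metis (no_types, lifting) empty_subsetI finite.emptyI mem_Collect_eq order_trans)

lemma weakly_null_T:
  assumes "weakly_null x"
  shows "weakly_null (\<lambda>n. T (x n))"
  using assms unfolding weakly_null_def by (auto simp: T_sym)

lemma weakly_null_lincomb:
  assumes "weakly_null x" "weakly_null y"
  shows "weakly_null (\<lambda>n. c *\<^sub>R x n - y n)"
  using assms unfolding weakly_null_def
  by (auto simp: bilinear intro!: tendsto_eq_intros)

text \<open>This is the asymptotic nonnegativity of \<open>c - T\<close>. After normalisation, the
  terms that are not short enter the weak neighbourhood on which no level above \<open>c\<close> is
  reached.\<close>

lemma eventually_form_le:
  assumes x: "weakly_null x" and M: "\<And>n. ip (x n) (x n) \<le> M"
    and c: "0 \<le> c" and non: "\<And>t. t > c \<Longrightarrow> \<not> essential_level t" and e: "e > 0"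
  shows "\<forall>\<^sub>F n in sequentially. ip (x n) (T (x n)) \<le> c * ip (x n) (x n) + e"
proof -
  \<comment> \<open>Makes the excess \<open>d\<close> times the squared norm at most
    \<open>e\<close>; the \<open>+ 1\<close> keeps the denominator positive.\<close>
  define d where "d = e / (\<bar>M\<bar> + 1)"
  have d: "d > 0" using e by (simp add: d_def)
  have xH: "x n \<in> H" for n using x by (simp add: weakly_null_def)
  obtain G where G: "finite G" "G \<subseteq> H" "\<And>f. f \<in> weak_nbhd G \<Longrightarrow> ip f (T f) < c + d"
    using non[of "c + d"] d by (auto simp: essential_level_def not_le)
  \<comment> \<open>A vector of norm above \<open>sqrt e\<close> with these pairings normalises into
    \<open>weak_nbhd G\<close>; for a shorter one \<open>T_le\<close> already gives the
    bound.\<close>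
  have "\<forall>\<^sub>F n in sequentially. \<forall>g\<in>G. \<bar>ip (x n) g\<bar> < sqrt e"
    using G(1,2) x e unfolding weakly_null_def
    by (intro eventually_ball_finite) (auto dest!: bspec subsetD simp: tendsto_iff dist_real_def)
  then show ?thesis
  proof eventually_elim
    case (elim n)
    show ?case
    proof (cases "ip (x n) (x n) \<le> e")
      case True
      moreover have "0 \<le> c * ip (x n) (x n)" using c xH by (simp add: nonneg)
      ultimately show ?thesis using T_le[OF xH[of n]] by linarith
    next
      case False
      define q where "q = sqrt (ip (x n) (x n))"
      have q: "q > sqrt e" "q > 0" "q\<^sup>2 = ip (x n) (x n)"
        using False e by (auto simp: q_def)
      define w where "w = (1/q) *\<^sub>R x n"
      have w: "w \<in> H" "x n = q *\<^sub>R w" using q xH by (auto simp: w_def)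
      have "w \<in> weak_nbhd G"
        unfolding weak_nbhd_def
      proof (safe intro!: w)
        show "ip w w \<le> 1" using q xH by (simp add: w_def bilinear power2_eq_square)
        fix g assume g: "g \<in> G"
        then have "\<bar>ip (x n) g\<bar> < sqrt e" using elim by blast
        then show "\<bar>ip w g\<bar> \<le> 1" using q xH g G(2) by (auto simp: w_def bilinear abs_mult)
      qed
      then have le: "ip w (T w) \<le> c + d" using G(3) by force
      have "ip (x n) (T (x n)) = q\<^sup>2 * ip w (T w)"
      proof -
        have "ip (x n) (T (x n)) = q * ip (T w) (q *\<^sub>R w)"
          using w by (simp add: scale_left T_sym)
        then show ?thesis using w by (simp add: scale_right T_sym power2_eq_square)
      qed
      also have "\<dots> \<le> q\<^sup>2 * (c + d)" using le by (intro mult_left_mono) auto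
      also have "\<dots> = c * ip (x n) (x n) + ip (x n) (x n) * d" using q by (simp add: algebra_simps)
      also have "ip (x n) (x n) * d \<le> (\<bar>M\<bar> + 1) * d" using M[of n] d by (intro mult_right_mono) auto
      also have "(\<bar>M\<bar> + 1) * d = e" by (simp add: d_def)
      finally show ?thesis by simp
    qed
  qed
qed

text \<open>The test vectors are the predecessors scaled by \<open>(real n + 1) * 2 ^ n\<close>, so
  that tolerance 1 in \<open>weak_nbhd\<close> is exactly the almost orthogonality that forces weak
  nullity.\<close>

lemma approximating_sequence:
  assumes "\<And>t. t < c \<Longrightarrow> essential_level t"
  obtains f where "weakly_null f" "\<And>n. ip (f n) (f n) \<le> 1"
    "\<And>n. c - 1 / (real n + 1) \<le> ip (f n) (T (f n))"
proof -
  \<comment> \<open>The guard makes \<open>P\<close> satisfiable for every history, as recursive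
    choice demands; that the chosen terms do lie in \<open>H\<close> follows afterwards by
    induction.\<close>
  define P where "P f n y \<longleftrightarrow> (\<forall>j<n. f j \<in> H) \<longrightarrow>
    y \<in> weak_nbhd ((\<lambda>j. ((real n + 1) * 2 ^ n) *\<^sub>R f j) ` {..<n}) \<and> c - 1 / (real n + 1) \<le> ip y (T y)"
    for f :: "nat \<Rightarrow> 'a" and n y
  have "\<exists>f. \<forall>n. P f n (f n)"
  proof (rule dependent_wf_choice[OF wf_less])
    show "P f n r = P g n r" if "\<And>z. (z, n) \<in> {(x, y). x < y} \<Longrightarrow> f z = g z" for f g n r
    proof -
      have "(\<lambda>j. ((real n + 1) * 2 ^ n) *\<^sub>R f j) ` {..<n} = (\<lambda>j. ((real n + 1) * 2 ^ n) *\<^sub>R g j) ` {..<n}"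
        using that by (intro image_cong) auto
      then show ?thesis using that by (simp add: P_def)
    qed
    show "\<exists>r. P f n r" for n f
    proof (cases "\<forall>j<n. f j \<in> H")
      case True
      then have "(\<lambda>j. ((real n + 1) * 2 ^ n) *\<^sub>R f j) ` {..<n} \<subseteq> H" by auto
      moreover have "essential_level (c - 1 / (real n + 1))" by (intro assms) simp
      ultimately show ?thesis
        unfolding essential_level_def P_def by (meson finite_imageI finite_lessThan)
    qed (auto simp: P_def)
  qed
  then obtain f where P: "\<And>n. P f n (f n)" by blast
  have fH: "f n \<in> H" for n
  proof (induction n rule: less_induct)
    case (less n)
    then show ?case using P[of n] by (simp add: P_def weak_nbhd_def)
  qed
  then have wn: "f n \<in> weak_nbhd ((\<lambda>j. ((real n + 1) * 2 ^ n) *\<^sub>R f j) ` {..<n})"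
    and lower: "c - 1 / (real n + 1) \<le> ip (f n) (T (f n))" for n
    using P[of n] by (auto simp: P_def)
  have norm: "ip (f n) (f n) \<le> 1" for n using wn[of n] by (simp add: weak_nbhd_def)
  have "weakly_null f"
  proof (rule weakly_null_almost_orthogonal[OF fH norm])
    fix j n :: nat assume "j < n"
    then have "\<bar>ip (f n) (((real n + 1) * 2 ^ n) *\<^sub>R f j)\<bar> \<le> 1"
      using wn[of n] by (auto simp: weak_nbhd_def)
    then show "(real n + 1) * 2 ^ n * \<bar>ip (f n) (f j)\<bar> \<le> 1"
      using fH by (simp add: bilinear abs_mult)
  qed
  then show thesis using that norm lower by blast
qed

text \<open>One descent step: the form of \<open>c - T\<close>, almost nonpositive at
  \<open>f\<close>, would become negative at \<open>f - g\<close> with \<open>g\<close> the residual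
  of \<open>f\<close>, unless \<open>g\<close> tends to zero. Step length 1 is admissible because
  the form of \<open>c - T\<close> is at most \<open>c \<le> 1\<close> times the squared
  norm.\<close>

lemma Weyl_sequence:
  assumes "essential_level c0" "0 < c0"
  obtains c f where "c0 \<le> c" "weakly_null f" "\<And>n. c - 1 / (real n + 1) \<le> ip (f n) (T (f n))"
    "\<And>n. ip (f n) (f n) \<le> 1"
    "(\<lambda>n. ip (c *\<^sub>R f n - T (f n)) (c *\<^sub>R f n - T (f n))) \<longlonglongrightarrow> 0"
proof -
  define c where "c = Sup {t. essential_level t}"
  have bdd: "bdd_above {t. essential_level t}" using essential_level_le_1 by (intro bdd_aboveI[of _ 1]) auto
  have c0: "c0 \<le> c" unfolding c_def using assms(1) bdd by (intro cSup_upper) auto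
  have c1: "c \<le> 1" unfolding c_def using assms(1) essential_level_le_1 by (intro cSup_least) auto
  have above: "\<not> essential_level t" if "t > c" for t
    using that bdd cSup_upper[of t "{t. essential_level t}"] by (auto simp: c_def)
  have below: "essential_level t" if "t < c" for t
  proof -
    have "\<exists>s\<in>{t. essential_level t}. t < s"
      using that assms(1) unfolding c_def by (intro less_cSupD) auto
    then obtain s where "essential_level s" "t < s" by blast
    then show ?thesis unfolding essential_level_def by (meson less_le_trans less_imp_le)
  qed
  obtain f where f: "weakly_null f" and norm: "\<And>n. ip (f n) (f n) \<le> 1"
    and lower: "\<And>n. c - 1 / (real n + 1) \<le> ip (f n) (T (f n))"
    using approximating_sequence[OF below] by blast
  have fH: "f n \<in> H" for n using f by (simp add: weakly_null_def)
  define g where "g n = c *\<^sub>R f n - T (f n)" for n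
  have g: "weakly_null g" unfolding g_def by (intro weakly_null_lincomb weakly_null_T f)
  have gH: "g n \<in> H" for n using g by (simp add: weakly_null_def)
  have gnorm: "ip (g n) (g n) \<le> 4" for n
  proof -
    have "ip (c *\<^sub>R f n) (c *\<^sub>R f n) = c\<^sup>2 * ip (f n) (f n)" using fH by (simp add: bilinear power2_eq_square)
    also have "\<dots> \<le> 1 * 1" using c0 c1 assms(2) norm[of n] nonneg[OF fH[of n]]
      by (intro mult_mono) (auto simp: power_le_one)
    finally show ?thesis
      using square_diff_le[of "c *\<^sub>R f n" "T (f n)"] fH T_norm_le[OF fH[of n]] norm[of n]
      by (simp add: g_def)
  qed
  define w where "w n = 1 *\<^sub>R f n - g n" for n
  have w: "weakly_null w" unfolding w_def by (rule weakly_null_lincomb[OF f g])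
  have wnorm: "ip (w n) (w n) \<le> 10" for n
    using square_diff_le[OF fH[of n] gH[of n]] norm[of n] gnorm[of n] by (simp add: w_def)
  \<comment> \<open>The form of \<open>c - T\<close> at \<open>w n\<close> is its value at
    \<open>f n\<close>, at most \<open>1 / (real n + 1)\<close>, minus twice the squared norm of
    \<open>g n\<close>, plus its value at \<open>g n\<close>, at most one squared norm of
    \<open>g n\<close>.\<close>
  have key: "ip (g n) (g n) \<le> 1 / (real n + 1) + (ip (w n) (T (w n)) - c * ip (w n) (w n))" for n
  proof -
    have Tg: "ip (f n) (T (g n)) = c * ip (f n) (g n) - ip (g n) (g n)"
    proof -
      have "ip (g n) (g n) = c * ip (f n) (g n) - ip (T (f n)) (g n)"
        using gH fH by (subst (1) g_def) (simp add: bilinear)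
      then show ?thesis using T_sym[OF fH gH] by simp
    qed
    have "ip (w n) (T (w n)) = ip (f n) (T (w n)) - ip (g n) (T (w n))"
      using fH gH by (simp add: w_def bilinear)
    also have "\<dots> = ip (T (f n)) (w n) - ip (T (g n)) (w n)"
      using fH gH by (simp add: w_def T_sym)
    also have "ip (T (f n)) (w n) = ip (f n) (T (f n)) - ip (f n) (T (g n))"
      using fH gH by (simp add: w_def diff_right T_sym)
    also have "ip (T (g n)) (w n) = ip (f n) (T (g n)) - ip (g n) (T (g n))"
      using fH gH by (simp add: w_def diff_right sym[of "T (g n)" "f n"] T_sym[of "g n" "g n"])
    finally have wT: "ip (w n) (T (w n)) =
        ip (f n) (T (f n)) - 2 * ip (f n) (T (g n)) + ip (g n) (T (g n))" by simp
    have gT: "0 \<le> ip (g n) (T (g n))"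
      by (rule T_nonneg[OF gH])
    have ww: "ip (w n) (w n) = ip (f n) (f n) - 2 * ip (f n) (g n) + ip (g n) (g n)"
      using fH gH by (simp add: w_def square_diff)
    have "c * ip (f n) (f n) \<le> c * 1" using norm[of n] c0 assms(2) by (intro mult_left_mono) auto
    moreover have "c * ip (g n) (g n) \<le> 1 * ip (g n) (g n)"
      using c1 nonneg[OF gH[of n]] by (intro mult_right_mono) auto
    ultimately show ?thesis using wT gT lower[of n] unfolding ww Tg by (simp add: algebra_simps)
  qed
  have "(\<lambda>n. ip (g n) (g n)) \<longlonglongrightarrow> 0"
  proof (rule LIMSEQ_I)
    fix e :: real assume e: "e > 0"
    have "\<forall>\<^sub>F n in sequentially. ip (w n) (T (w n)) \<le> c * ip (w n) (w n) + e/2"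
      by (rule eventually_form_le[OF w wnorm]) (use c0 assms(2) above e in auto)
    moreover have "\<forall>\<^sub>F n in sequentially. 1 / (real n + 1) < e/2"
      using LIMSEQ_inverse_real_of_nat e
      by (intro order_tendstoD(2)[where y=0]) (auto simp: inverse_eq_divide add.commute)
    ultimately have "\<forall>\<^sub>F n in sequentially. norm (ip (g n) (g n) - 0) < e"
    proof eventually_elim
      case (elim n)
      then show ?case using key[of n] nonneg[OF gH[of n]] by simp
    qed
    then show "\<exists>no. \<forall>n\<ge>no. norm (ip (g n) (g n) - 0) < e" by (simp add: eventually_sequentially)
  qed
  then show thesis using that[OF c0 f lower norm] by (simp add: g_def)
qed

end

section \<open>The resolvent of a closable form\<close>

text \<open>Completeness concerns \<open>ip\<close>-Cauchy sequences of the core, with limits in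
  \<open>H\<close>; the closed form is reached only through sequences in \<open>D\<close>.\<close>

locale form_on_core = H: semi_inner_space H ip + D: semi_inner_space D e
  for H :: "'a::real_vector set" and ip and D :: "'a set" and e +
  assumes D_subset: "D \<subseteq> H"
    and complete: "\<And>x. (\<And>n. x n \<in> D) \<Longrightarrow>
      (\<And>d. d > 0 \<Longrightarrow> \<exists>N. \<forall>k\<ge>N. \<forall>m\<ge>N. ip (x k - x m) (x k - x m) < d) \<Longrightarrow>
      \<exists>u\<in>H. (\<lambda>n. ip (x n - u) (x n - u)) \<longlonglongrightarrow> 0"
begin

definition e1 :: "'a \<Rightarrow> 'a \<Rightarrow> real" where "e1 x y = e x y + ip x y"

lemma in_H: "x \<in> D \<Longrightarrow> x \<in> H" using D_subset by auto

sublocale E1: semi_inner_space D e1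
  using in_H
  by unfold_locales
    (auto simp: D.subspace_S e1_def D.sym H.sym D.bilinear H.bilinear D.nonneg H.nonneg algebra_simps)

lemma ip_le_e1: "x \<in> D \<Longrightarrow> ip x x \<le> e1 x x"
  by (simp add: e1_def D.nonneg)

lemma e_le_e1: "x \<in> D \<Longrightarrow> e x x \<le> e1 x x"
  by (simp add: e1_def in_H H.nonneg)

text \<open>Weak solutions of \<open>(A + 1) u = f\<close> as limits of approximate solutions in the core \<open>D\<close>;
  the bound being uniform in the test vector \<open>y\<close> forces \<open>x\<close> to be Cauchy for \<open>e1\<close>.\<close>
definition solves :: "'a \<Rightarrow> 'a \<Rightarrow> (nat \<Rightarrow> 'a) \<Rightarrow> (nat \<Rightarrow> real) \<Rightarrow> bool" where
  "solves f u x p \<longleftrightarrow> f \<in> H \<and> u \<in> H \<and> (\<forall>n. x n \<in> D) \<and> p \<longlonglongrightarrow> 0 \<and>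
     (\<forall>n. \<forall>y\<in>D. (e1 (x n) y - ip f y)\<^sup>2 \<le> p n * e1 y y) \<and>
     (\<lambda>n. ip (x n - u) (x n - u)) \<longlonglongrightarrow> 0"

text \<open>Testing both bounds on \<open>y = x k - x m\<close>, the difference of the two errors is
  \<open>e1 y y\<close> itself, so its square is at most \<open>2 * (p k + p m)\<close> times
  itself.\<close>

lemma approx_Cauchy:
  assumes x: "\<And>n. x n \<in> D" and bd: "\<And>n y. y \<in> D \<Longrightarrow> (e1 (x n) y - ip f y)\<^sup>2 \<le> p n * e1 y y"
    and p: "p \<longlonglongrightarrow> 0" and d: "d > 0"
  shows "\<exists>N. \<forall>k\<ge>N. \<forall>m\<ge>N. e1 (x k - x m) (x k - x m) < d"
proof -
  have le: "e1 (x k - x m) (x k - x m) \<le> 2 * (p k + p m)" if pos: "e1 (x k - x m) (x k - x m) > 0" for k m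
  proof -
    define y where "y = x k - x m"
    define s where "s = e1 y y"
    have y: "y \<in> D" using x by (simp add: y_def)
    have sab: "(a - b)\<^sup>2 \<le> 2 * a\<^sup>2 + 2 * b\<^sup>2" for a b :: real
      using zero_le_power2[of "a + b"] by (simp add: power2_eq_square algebra_simps)
    have "s = (e1 (x k) y - ip f y) - (e1 (x m) y - ip f y)"
      using x y by (simp add: s_def E1.diff_left[symmetric] y_def)
    then have "s\<^sup>2 \<le> 2 * (e1 (x k) y - ip f y)\<^sup>2 + 2 * (e1 (x m) y - ip f y)\<^sup>2"
      by (simp only: sab)
    also have "\<dots> \<le> 2 * (p k * s) + 2 * (p m * s)"
      using bd[OF y, of k] bd[OF y, of m] by (simp add: s_def)
    finally have "s * s \<le> (2 * (p k + p m)) * s" by (simp add: power2_eq_square algebra_simps)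
    then show ?thesis using pos unfolding s_def y_def by (simp add: mult_le_cancel_right)
  qed
  obtain N where N: "\<And>n. n \<ge> N \<Longrightarrow> p n < d / 4"
    using order_tendstoD(2)[OF p, of "d/4"] d by (auto simp: eventually_sequentially)
  have "e1 (x k - x m) (x k - x m) < d" if "k \<ge> N" "m \<ge> N" for k m
    using le[of k m] N[OF that(1)] N[OF that(2)] d by (cases "e1 (x k - x m) (x k - x m) > 0") auto
  then show ?thesis by blast
qed

text \<open>Dirichlet principle: the infimum of \<open>J\<close> need not be attained in
  \<open>D\<close>, but a minimising sequence satisfies the Euler equation up to an error governed
  by its slack.\<close>

lemma solves_exists:
  assumes f: "f \<in> H"
  shows "\<exists>u x p. solves f u x p"
proof -
  define J where "J x = e1 x x - 2 * ip f x" for x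
  have low: "- ip f f \<le> J x" if x: "x \<in> D" for x
    using ip_le_e1[OF x] H.nonneg[of "x - f"] H.square_diff[of x f] f in_H[OF x]
    by (simp add: J_def H.sym[of x f])
  then have bdd: "bdd_below (J ` D)" by (auto intro!: bdd_belowI)
  define I where "I = Inf (J ` D)"
  have I: "I \<le> J x" if "x \<in> D" for x unfolding I_def using that bdd by (intro cInf_lower) auto
  have "\<exists>x\<in>D. J x < I + 1 / (real n + 1)" for n
  proof -
    have "J ` D \<noteq> {}" using D.closed(4) by blast
    moreover have "Inf (J ` D) < I + 1 / (real n + 1)" by (simp add: I_def)
    ultimately have "\<exists>z\<in>J ` D. z < I + 1 / (real n + 1)" by (rule cInf_lessD)
    then show ?thesis by blast
  qed
  then obtain x where x: "\<And>n. x n \<in> D" and xJ: "\<And>n. J (x n) < I + 1 / (real n + 1)" by metis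
  \<comment> \<open>Along the line \<open>x n + t *\<^sub>R y\<close> the value of \<open>J\<close>
    stays above the infimum, so the quadratic with the slack as constant term is nonnegative; its
    discriminant gives the bound.\<close>
  have bd: "(e1 (x n) y - ip f y)\<^sup>2 \<le> (1 / (real n + 1)) * e1 y y" if y: "y \<in> D" for n y
  proof (rule quadratic_nonneg_imp_discriminant[OF E1.nonneg[OF y]])
    fix t
    have "J (x n + t *\<^sub>R y) = J (x n) + 2 * t * (e1 (x n) y - ip f y) + t\<^sup>2 * e1 y y"
      using x[of n] y f in_H by (simp add: J_def E1.square_add_scale H.bilinear algebra_simps)
    then show "0 \<le> 1 / (real n + 1) + 2 * t * (e1 (x n) y - ip f y) + t\<^sup>2 * e1 y y"
      using I[of "x n + t *\<^sub>R y"] xJ[of n] x y by simp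
  qed
  have p: "(\<lambda>n. 1 / (real n + 1)) \<longlonglongrightarrow> 0"
    using LIMSEQ_inverse_real_of_nat by (simp add: inverse_eq_divide add.commute)
  have "\<exists>u\<in>H. (\<lambda>n. ip (x n - u) (x n - u)) \<longlonglongrightarrow> 0"
  proof (rule complete[OF x])
    fix d :: real assume "d > 0"
    from approx_Cauchy[OF x bd p this]
    obtain N where "\<forall>k\<ge>N. \<forall>m\<ge>N. e1 (x k - x m) (x k - x m) < d" by blast
    moreover have "ip (x k - x m) (x k - x m) \<le> e1 (x k - x m) (x k - x m)" for k m
      by (intro ip_le_e1 D.closed x)
    ultimately show "\<exists>N. \<forall>k\<ge>N. \<forall>m\<ge>N. ip (x k - x m) (x k - x m) < d"
      using le_less_trans by blast
  qed
  then show ?thesis unfolding solves_def using f x bd p by blast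
qed

section \<open>Estimates for a single weak solution\<close>

context
  fixes f u x p assumes sol: "solves f u x p"
begin

lemma solves_mem: "f \<in> H" "u \<in> H" "x n \<in> D" "x n \<in> H"
  using sol in_H by (auto simp: solves_def)

lemma solves_tendsto_ip: "h \<in> H \<Longrightarrow> (\<lambda>n. ip h (x n)) \<longlonglongrightarrow> ip h u"
  using sol solves_mem by (intro H.tendsto_right) (auto simp: solves_def)

lemma solves_Cauchy: "d > 0 \<Longrightarrow> \<exists>N. \<forall>k\<ge>N. \<forall>m\<ge>N. e1 (x k - x m) (x k - x m) < d"
  using sol by (intro approx_Cauchy[where f=f and p=p]) (auto simp: solves_def)

text \<open>Testing the approximate equation with \<open>x n\<close> itself bounds the square of its
  \<open>e1\<close>-energy by a constant times that energy.\<close>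

lemma solves_bounded: "\<exists>C. \<forall>n. e1 (x n) (x n) \<le> C"
proof -
  obtain K where K: "\<And>n. p n \<le> K"
    using sol convergent_imp_bounded[of p] unfolding solves_def convergent_def
    by (metis bounded_iff rangeI abs_le_D1 real_norm_def)
  have "e1 (x n) (x n) \<le> 2 * (\<bar>K\<bar> + ip f f)" for n
  proof (cases "e1 (x n) (x n) > 0")
    case True
    define s where "s = e1 (x n) (x n)"
    have "(s - ip f (x n))\<^sup>2 \<le> p n * s" using sol by (simp add: s_def solves_def)
    also have "\<dots> \<le> \<bar>K\<bar> * s" using K[of n] True by (intro mult_right_mono) (auto simp: s_def)
    finally have 1: "(s - ip f (x n))\<^sup>2 \<le> \<bar>K\<bar> * s" .
    have "(ip f (x n))\<^sup>2 \<le> ip f f * ip (x n) (x n)" using solves_mem by (intro H.Cauchy_Schwarz)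
    also have "\<dots> \<le> ip f f * s"
      using solves_mem by (intro mult_left_mono) (auto simp: s_def ip_le_e1 H.nonneg)
    finally have 2: "(ip f (x n))\<^sup>2 \<le> ip f f * s" .
    have "s\<^sup>2 \<le> 2 * (s - ip f (x n))\<^sup>2 + 2 * (ip f (x n))\<^sup>2"
      using zero_le_power2[of "s - 2 * ip f (x n)"] by (simp add: power2_eq_square algebra_simps)
    also have "\<dots> \<le> (2 * (\<bar>K\<bar> + ip f f)) * s" using 1 2 by (simp add: algebra_simps)
    finally show ?thesis using True unfolding s_def by (simp add: power2_eq_square mult_le_cancel_right)
  next
    case False
    then show ?thesis using H.nonneg[of f] solves_mem(1) by simp
  qed
  then show ?thesis by blast
qed

text \<open>Test vectors may vary with \<open>n\<close> as long as their energy is bounded. This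
  allows \<open>y = x\<close>, which gives the limit of the energy, and \<open>y\<close>
  approximating another solution, which gives symmetry.\<close>

lemma solves_tendsto_bounded:
  assumes y: "\<And>n. y n \<in> D" and C: "\<And>n. e1 (y n) (y n) \<le> C"
  shows "(\<lambda>n. e1 (x n) (y n) - ip f (y n)) \<longlonglongrightarrow> 0"
proof -
  have "(\<lambda>n. (e1 (x n) (y n) - ip f (y n))\<^sup>2) \<longlonglongrightarrow> 0"
  proof (rule tendsto_sandwich[OF _ _ tendsto_const])
    show "\<forall>\<^sub>F n in sequentially. (e1 (x n) (y n) - ip f (y n))\<^sup>2 \<le> \<bar>p n\<bar> * C"
    proof (rule always_eventually, rule allI)
      fix n
      have "(e1 (x n) (y n) - ip f (y n))\<^sup>2 \<le> p n * e1 (y n) (y n)"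
        using sol y by (simp add: solves_def)
      also have "\<dots> \<le> \<bar>p n\<bar> * C" using C y by (intro mult_mono) (auto simp: E1.nonneg)
      finally show "(e1 (x n) (y n) - ip f (y n))\<^sup>2 \<le> \<bar>p n\<bar> * C" .
    qed
    have "p \<longlonglongrightarrow> 0" using sol by (simp add: solves_def)
    then have "(\<lambda>n. \<bar>p n\<bar> * C) \<longlonglongrightarrow> \<bar>0\<bar> * C" by (intro tendsto_intros)
    then show "(\<lambda>n. \<bar>p n\<bar> * C) \<longlonglongrightarrow> 0" by simp
  qed simp
  then have "(\<lambda>n. sqrt ((e1 (x n) (y n) - ip f (y n))\<^sup>2)) \<longlonglongrightarrow> sqrt 0" by (intro tendsto_intros)
  then show ?thesis by (simp add: tendsto_rabs_zero_iff)
qed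

lemma solves_tendsto_e1:
  assumes "y \<in> D" shows "(\<lambda>n. e1 (x n) y) \<longlonglongrightarrow> ip f y"
  using solves_tendsto_bounded[of "\<lambda>_. y" "e1 y y"] assms LIM_zero_cancel by auto

lemma solves_tendsto_energy: "(\<lambda>n. e1 (x n) (x n)) \<longlonglongrightarrow> ip f u"
proof -
  obtain C where "\<And>n. e1 (x n) (x n) \<le> C" using solves_bounded by blast
  then have "(\<lambda>n. (e1 (x n) (x n) - ip f (x n)) + ip f (x n)) \<longlonglongrightarrow> 0 + ip f u"
    using solves_mem by (intro tendsto_intros solves_tendsto_bounded solves_tendsto_ip)
  then show ?thesis by simp
qed

lemma solves_norm_le: "ip u u \<le> ip f u"
proof (rule LIMSEQ_le[OF _ solves_tendsto_energy])
  show "(\<lambda>n. ip (x n) (x n)) \<longlonglongrightarrow> ip u u"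
    using sol solves_mem by (intro H.tendsto_square) (auto simp: solves_def)
  show "\<exists>N. \<forall>n\<ge>N. ip (x n) (x n) \<le> e1 (x n) (x n)" using solves_mem ip_le_e1 by blast
qed

lemma solves_form_le: "ip f u \<le> ip f f"
proof (cases "ip f u > 0")
  case True
  have "(ip f u)\<^sup>2 \<le> ip f f * ip u u" using solves_mem by (intro H.Cauchy_Schwarz)
  also have "\<dots> \<le> ip f f * ip f u"
    using solves_mem solves_norm_le by (intro mult_left_mono) (auto simp: H.nonneg)
  finally show ?thesis using True by (simp add: power2_eq_square)
qed (use H.nonneg[OF solves_mem(1)] in simp)

text \<open>Cauchy-Schwarz for \<open>e1\<close>, passed to the limit. It is the half of the dual
  formula for the quadratic form of the resolvent that turns small energy of \<open>y\<close> into a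
  large \<open>ip f u\<close>.\<close>

lemma solves_variational:
  assumes "y \<in> D" shows "(ip f y)\<^sup>2 \<le> ip f u * e1 y y"
proof (rule LIMSEQ_le)
  show "(\<lambda>n. (e1 (x n) y)\<^sup>2) \<longlonglongrightarrow> (ip f y)\<^sup>2"
    by (intro tendsto_intros solves_tendsto_e1 assms)
  show "(\<lambda>n. e1 (x n) (x n) * e1 y y) \<longlonglongrightarrow> ip f u * e1 y y"
    by (intro tendsto_intros solves_tendsto_energy)
  show "\<exists>N. \<forall>n\<ge>N. (e1 (x n) y)\<^sup>2 \<le> e1 (x n) (x n) * e1 y y"
    using E1.Cauchy_Schwarz solves_mem assms by blast
qed

text \<open>Needed for normalising Weyl vectors: a multiple of \<open>resolvent f\<close> is a
  solution for the multiple of \<open>f\<close>, but not necessarily the one selected by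
  \<open>resolvent\<close>.\<close>

lemma solves_scale: "solves (r *\<^sub>R f) (r *\<^sub>R u) (\<lambda>n. r *\<^sub>R x n) (\<lambda>n. r\<^sup>2 * p n)"
  unfolding solves_def
proof (intro conjI allI ballI)
  show "r *\<^sub>R f \<in> H" "r *\<^sub>R u \<in> H" "r *\<^sub>R x n \<in> D" for n using solves_mem by auto
  have "(\<lambda>n. r\<^sup>2 * p n) \<longlonglongrightarrow> r\<^sup>2 * 0" using sol by (intro tendsto_intros) (simp add: solves_def)
  then show "(\<lambda>n. r\<^sup>2 * p n) \<longlonglongrightarrow> 0" by simp
  show "(e1 (r *\<^sub>R x n) y - ip (r *\<^sub>R f) y)\<^sup>2 \<le> r\<^sup>2 * p n * e1 y y" if y: "y \<in> D" for n y
  proof -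
    have "(e1 (r *\<^sub>R x n) y - ip (r *\<^sub>R f) y)\<^sup>2 = r\<^sup>2 * (e1 (x n) y - ip f y)\<^sup>2"
      using solves_mem y in_H by (simp add: E1.bilinear H.bilinear power_mult_distrib flip: right_diff_distrib)
    also have "\<dots> \<le> r\<^sup>2 * (p n * e1 y y)" using sol y by (intro mult_left_mono) (auto simp: solves_def)
    finally show ?thesis by (simp add: mult.assoc)
  qed
  have "r *\<^sub>R x n - r *\<^sub>R u = r *\<^sub>R (x n - u)" for n by (simp add: scaleR_diff_right)
  then have "ip (r *\<^sub>R x n - r *\<^sub>R u) (r *\<^sub>R x n - r *\<^sub>R u) = r\<^sup>2 * ip (x n - u) (x n - u)" for n
    using solves_mem by (simp add: H.scale_left H.scale_right power2_eq_square)
  moreover have "(\<lambda>n. r\<^sup>2 * ip (x n - u) (x n - u)) \<longlonglongrightarrow> r\<^sup>2 * 0"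
    using sol by (intro tendsto_intros) (simp add: solves_def)
  ultimately show "(\<lambda>n. ip (r *\<^sub>R x n - r *\<^sub>R u) (r *\<^sub>R x n - r *\<^sub>R u)) \<longlonglongrightarrow> 0" by simp
qed

end

text \<open>Both sides are the limit of \<open>e1 (x n) (y n)\<close>, read once as the equation for
  \<open>f\<close> tested with \<open>y n\<close> and once as the equation for \<open>g\<close>
  tested with \<open>x n\<close>.\<close>

lemma solves_sym:
  assumes f: "solves f u x p" and g: "solves g v y q"
  shows "ip f v = ip g u"
proof -
  note mf = solves_mem[OF f] and mg = solves_mem[OF g]
  obtain C where "\<And>n. e1 (y n) (y n) \<le> C" using solves_bounded[OF g] by blast
  then have "(\<lambda>n. (e1 (x n) (y n) - ip f (y n)) + ip f (y n)) \<longlonglongrightarrow> 0 + ip f v"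
    using mf mg by (intro tendsto_intros solves_tendsto_bounded[OF f] solves_tendsto_ip[OF g]) auto
  moreover obtain C' where "\<And>n. e1 (x n) (x n) \<le> C'" using solves_bounded[OF f] by blast
  then have "(\<lambda>n. (e1 (y n) (x n) - ip g (x n)) + ip g (x n)) \<longlonglongrightarrow> 0 + ip g u"
    using mf mg by (intro tendsto_intros solves_tendsto_bounded[OF g] solves_tendsto_ip[OF f]) auto
  ultimately show ?thesis
    using mf mg by (intro LIMSEQ_unique[of "\<lambda>n. e1 (x n) (y n)"]) (simp_all add: E1.sym[of "y _"])
qed

text \<open>Solutions are determined only up to vectors of seminorm zero, hence the choice of a
  representative.\<close>

definition resolvent :: "'a \<Rightarrow> 'a" where
  "resolvent f = (SOME u. \<exists>x p. solves f u x p)"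

lemma resolvent_solves:
  assumes "f \<in> H"
  obtains x p where "solves f (resolvent f) x p"
  using someI_ex[OF solves_exists[OF assms]] unfolding resolvent_def by blast

sublocale bounded_positive_operator H ip resolvent
proof
  fix f assume f: "f \<in> H"
  obtain x p where s: "solves f (resolvent f) x p" using resolvent_solves[OF f] .
  show "resolvent f \<in> H" using solves_mem[OF s] by simp
  then show "0 \<le> ip f (resolvent f)" using solves_norm_le[OF s] H.nonneg by fastforce
  show "ip f (resolvent f) \<le> ip f f" by (rule solves_form_le[OF s])
  then show "ip (resolvent f) (resolvent f) \<le> ip f f" using solves_norm_le[OF s] by simp
  fix g assume g: "g \<in> H"
  obtain y q where t: "solves g (resolvent g) y q" using resolvent_solves[OF g] .
  show "ip (resolvent f) g = ip f (resolvent g)"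
    using solves_sym[OF s t] solves_mem[OF s] g H.sym by simp
qed

text \<open>Here \<open>f\<close> is right-hand side and test vector at once; in the second role it
  is replaced by its approximants in the core.\<close>

lemma resolvent_variational:
  assumes f: "f \<in> H" and x: "\<And>n. x n \<in> D" and lim: "(\<lambda>n. ip (x n - f) (x n - f)) \<longlonglongrightarrow> 0"
    and E: "(\<lambda>n. e (x n) (x n)) \<longlonglongrightarrow> E"
  shows "(ip f f)\<^sup>2 \<le> ip f (resolvent f) * (E + ip f f)"
proof -
  obtain y p where s: "solves f (resolvent f) y p" using resolvent_solves[OF f] .
  show ?thesis
  proof (rule LIMSEQ_le)
    show "(\<lambda>n. (ip f (x n))\<^sup>2) \<longlonglongrightarrow> (ip f f)\<^sup>2"
      by (intro tendsto_intros H.tendsto_right f x in_H lim)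
    show "(\<lambda>n. ip f (resolvent f) * e1 (x n) (x n)) \<longlonglongrightarrow> ip f (resolvent f) * (E + ip f f)"
      unfolding e1_def by (intro tendsto_intros H.tendsto_square f x in_H lim E)
    show "\<exists>N. \<forall>n\<ge>N. (ip f (x n))\<^sup>2 \<le> ip f (resolvent f) * e1 (x n) (x n)"
      using solves_variational[OF s] x by blast
  qed
qed

text \<open>The eigenvalue \<open>c\<close> of the resolvent corresponds to the eigenvalue \<open>1 / c - 1\<close> of the operator.\<close>
lemma singular_Weyl_sequence:
  assumes "essential_level c0" "0 < c0"
  obtains c f u where "c0 \<le> c" "\<And>n. \<exists>x p. solves (f n) (u n) x p" "\<And>n. ip (u n) (u n) = 1"
    "H.weakly_null u"
    "(\<lambda>n. ip (f n - (1/c) *\<^sub>R u n) (f n - (1/c) *\<^sub>R u n)) \<longlonglongrightarrow> 0"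
proof -
  obtain c F where c: "c0 \<le> c" and wF: "H.weakly_null F"
    and low: "\<And>n. c - 1 / (real n + 1) \<le> ip (F n) (resolvent (F n))"
    and norm: "\<And>n. ip (F n) (F n) \<le> 1"
    and lim: "(\<lambda>n. ip (c *\<^sub>R F n - resolvent (F n)) (c *\<^sub>R F n - resolvent (F n))) \<longlonglongrightarrow> 0"
    by (rule Weyl_sequence[OF assms], rule that)
  have cpos: "c > 0" using c assms(2) by simp
  have FH: "F n \<in> H" for n using wF by (simp add: H.weakly_null_def)
  \<comment> \<open>Shifting the index by \<open>N\<close> makes the defect at most
    \<open>c / 2\<close>, so every image has norm at least \<open>c / 2\<close> and can be
    normalised.\<close>
  obtain N :: nat where "2 / c < real N" using reals_Archimedean2 by blast
  then have N: "real N + 1 > 2 / c" by simp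
  define U where "U n = resolvent (F (n + N))" for n
  define q where "q n = sqrt (ip (U n) (U n))" for n
  have UH: "U n \<in> H" for n using FH by (simp add: U_def)
  have q: "q n \<ge> c / 2" for n
  proof -
    have "1 / (real (n + N) + 1) \<le> 1 / (real N + 1)" by (intro divide_left_mono) auto
    also have "\<dots> \<le> c / 2" using N cpos by (simp add: field_simps)
    finally have "c / 2 \<le> ip (F (n+N)) (U n)" using low[of "n + N"] by (simp add: U_def)
    also have "\<dots> \<le> sqrt (ip (F (n+N)) (F (n+N))) * q n"
      using H.abs_le_sqrt[OF FH UH] unfolding q_def by (meson abs_ge_self order_trans)
    also have "\<dots> \<le> 1 * q n"
      using norm by (intro mult_right_mono) (auto simp: q_def H.nonneg UH)
    finally show ?thesis by simp
  qed
  have qpos: "q n > 0" and qinv: "1 / q n \<le> 2 / c" for n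
    using q[of n] cpos by (auto simp: field_simps)
  have qsq: "q n * q n = ip (U n) (U n)" for n using UH H.nonneg by (simp add: q_def)
  define f where "f n = (1 / q n) *\<^sub>R F (n + N)" for n
  define u where "u n = (1 / q n) *\<^sub>R U n" for n
  show thesis
  proof (rule that[OF c, of f u])
    show "\<exists>x p. solves (f n) (u n) x p" for n
    proof -
      obtain x p where "solves (F (n + N)) (U n) x p" using resolvent_solves[OF FH] U_def by metis
      from solves_scale[OF this] show ?thesis unfolding f_def u_def by blast
    qed
    show "ip (u n) (u n) = 1" for n
      using UH qpos[of n] by (simp add: u_def H.bilinear qsq[symmetric])
    have "H.weakly_null (\<lambda>n. resolvent (F n))" by (rule weakly_null_T[OF wF])
    then have "H.weakly_null U" unfolding H.weakly_null_def U_def by (auto intro: LIMSEQ_ignore_initial_segment)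
    then have U: "(\<lambda>n. ip (U n) h) \<longlonglongrightarrow> 0" if "h \<in> H" for h using that by (simp add: H.weakly_null_def)
    have bq: "Bfun (\<lambda>n. 1 / q n) sequentially"
      using qpos qinv by (intro BfunI[of _ "2 / c"]) (auto simp: less_imp_le)
    show "H.weakly_null u"
      unfolding H.weakly_null_def
    proof (intro conjI allI ballI)
      show "u n \<in> H" for n using UH by (simp add: u_def)
      fix h assume h: "h \<in> H"
      have "(\<lambda>n. (1 / q n) * ip (U n) h) \<longlonglongrightarrow> 0"
        using bounded_bilinear.Bfun_prod_Zfun[OF bounded_bilinear_mult bq] U[OF h]
        by (simp add: tendsto_Zfun_iff)
      then show "(\<lambda>n. ip (u n) h) \<longlonglongrightarrow> 0" using UH h by (simp add: u_def H.bilinear)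
    qed
    define G where "G n = c *\<^sub>R F (n + N) - U n" for n
    have GH: "G n \<in> H" for n using FH UH by (simp add: G_def)
    have G0: "(\<lambda>n. ip (G n) (G n)) \<longlonglongrightarrow> 0"
      unfolding G_def U_def by (rule LIMSEQ_ignore_initial_segment[OF lim])
    \<comment> \<open>The residual of the normalised pair is the old residual divided by
      \<open>c * q n\<close>, and \<open>q n\<close> is bounded away from zero.\<close>
    have eq: "f n - (1/c) *\<^sub>R u n = (1 / (c * q n)) *\<^sub>R G n" for n
      using cpos by (simp add: f_def u_def G_def scaleR_diff_right)
    show "(\<lambda>n. ip (f n - (1/c) *\<^sub>R u n) (f n - (1/c) *\<^sub>R u n)) \<longlonglongrightarrow> 0"
    proof (rule tendsto_sandwich[OF _ _ tendsto_const])
      show "\<forall>\<^sub>F n in sequentially. 0 \<le> ip (f n - (1/c) *\<^sub>R u n) (f n - (1/c) *\<^sub>R u n)"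
        using GH by (simp add: eq H.nonneg)
      show "\<forall>\<^sub>F n in sequentially. ip (f n - (1/c) *\<^sub>R u n) (f n - (1/c) *\<^sub>R u n) \<le> (2 / c\<^sup>2)\<^sup>2 * ip (G n) (G n)"
      proof (rule always_eventually, rule allI)
        fix n
        have "1 / (c * q n) = (1 / c) * (1 / q n)" by simp
        also have "\<dots> \<le> (1 / c) * (2 / c)" using qinv cpos by (intro mult_left_mono) auto
        finally have "1 / (c * q n) \<le> 2 / c\<^sup>2" by (simp add: power2_eq_square)
        then have "(1 / (c * q n))\<^sup>2 \<le> (2 / c\<^sup>2)\<^sup>2" using qpos cpos by (intro power_mono) (auto simp: less_imp_le)
        then have "(1 / (c * q n))\<^sup>2 * ip (G n) (G n) \<le> (2 / c\<^sup>2)\<^sup>2 * ip (G n) (G n)"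
          using GH by (intro mult_right_mono) (auto simp: H.nonneg)
        moreover have "ip (f n - (1/c) *\<^sub>R u n) (f n - (1/c) *\<^sub>R u n) = (1 / (c * q n))\<^sup>2 * ip (G n) (G n)"
          using GH by (simp only: eq H.scale_left H.scale_right H.closed power2_eq_square mult.assoc)
        ultimately show "ip (f n - (1/c) *\<^sub>R u n) (f n - (1/c) *\<^sub>R u n) \<le> (2 / c\<^sup>2)\<^sup>2 * ip (G n) (G n)" by simp
      qed
      have "(\<lambda>n. (2 / c\<^sup>2)\<^sup>2 * ip (G n) (G n)) \<longlonglongrightarrow> (2 / c\<^sup>2)\<^sup>2 * 0" by (intro tendsto_intros G0)
      then show "(\<lambda>n. (2 / c\<^sup>2)\<^sup>2 * ip (G n) (G n)) \<longlonglongrightarrow> 0" by simp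
    qed
  qed
qed

end

section \<open>Square integrable functions\<close>

text \<open>Pointwise scaling, so that spaces of functions can instantiate the abstract
  locales.\<close>

instantiation "fun" :: (type, real_vector) real_vector
begin

definition scaleR_fun :: "real \<Rightarrow> ('a \<Rightarrow> 'b) \<Rightarrow> 'a \<Rightarrow> 'b" where
  "scaleR_fun r f = (\<lambda>x. r *\<^sub>R f x)"

instance
  by standard (auto simp: scaleR_fun_def fun_eq_iff scaleR_add_right scaleR_add_left)

end

lemma scaleR_fun_apply [simp]: "(r *\<^sub>R f) x = r *\<^sub>R f x"
  by (simp add: scaleR_fun_def)

definition square_integrable :: "'a measure \<Rightarrow> ('a \<Rightarrow> real) set" where
  "square_integrable M = {f \<in> borel_measurable M. integrable M (\<lambda>x. (f x)\<^sup>2)}"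

lemma square_integrableD [measurable_dest]: "f \<in> square_integrable M \<Longrightarrow> f \<in> borel_measurable M"
  by (simp add: square_integrable_def)

lemma integrable_square: "f \<in> square_integrable M \<Longrightarrow> integrable M (\<lambda>x. (f x)\<^sup>2)"
  by (simp add: square_integrable_def)

lemma integrable_mult_square_integrable:
  assumes f: "f \<in> square_integrable M" and g: "g \<in> square_integrable M"
  shows "integrable M (\<lambda>x. f x * g x)"
proof (rule Bochner_Integration.integrable_bound)
  show "integrable M (\<lambda>x. (f x)\<^sup>2 + (g x)\<^sup>2)" using integrable_square[OF f] integrable_square[OF g] by simp
  show "(\<lambda>x. f x * g x) \<in> borel_measurable M"
    using square_integrableD[OF f] square_integrableD[OF g] by simp
  have "\<bar>a * b\<bar> \<le> a\<^sup>2 + b\<^sup>2" for a b :: real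
    using sum_squares_bound[of "\<bar>a\<bar>" "\<bar>b\<bar>"] mult_nonneg_nonneg[of "\<bar>a\<bar>" "\<bar>b\<bar>"]
    unfolding abs_mult power2_abs by linarith
  then show "AE x in M. norm (f x * g x) \<le> norm ((f x)\<^sup>2 + (g x)\<^sup>2)" by simp
qed

lemma square_integrable_add:
  assumes f: "f \<in> square_integrable M" and g: "g \<in> square_integrable M"
  shows "f + g \<in> square_integrable M"
proof -
  have "integrable M (\<lambda>x. (f x)\<^sup>2 + (g x)\<^sup>2 + 2 * (f x * g x))"
    using integrable_square[OF f] integrable_square[OF g] integrable_mult_square_integrable[OF f g]
    by simp
  then show ?thesis using square_integrableD[OF f] square_integrableD[OF g]
    by (simp add: square_integrable_def power2_sum plus_fun_def mult.assoc)
qed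

lemma square_integrable_scaleR:
  assumes f: "f \<in> square_integrable M"
  shows "r *\<^sub>R f \<in> square_integrable M"
  using integrable_square[OF f] square_integrableD[OF f]
  by (simp add: square_integrable_def power_mult_distrib scaleR_fun_def)

lemma semi_inner_square_integrable:
  "semi_inner_space (square_integrable M) (\<lambda>f g. \<integral>x. f x * g x \<partial>M)"
proof
  show "subspace (square_integrable M)"
    unfolding subspace_def
    by (auto intro: square_integrable_add square_integrable_scaleR)
       (simp add: square_integrable_def zero_fun_def)
qed (auto simp: mult.commute algebra_simps integrable_mult_square_integrable)

text \<open>On a finite measure an L^2-Cauchy sequence is L^1-Cauchy, which yields a subsequence
  converging almost everywhere; Fatou's lemma returns the limit to L^2.\<close>

lemma square_integrable_complete:
  assumes fin: "finite_measure M" and s: "\<And>n. s n \<in> square_integrable M"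
    and Cau: "\<And>d. d > 0 \<Longrightarrow> \<exists>N. \<forall>k\<ge>N. \<forall>m\<ge>N. (\<integral>x. (s k x - s m x)\<^sup>2 \<partial>M) < d"
  shows "\<exists>u\<in>square_integrable M. (\<lambda>n. \<integral>x. (s n x - u x)\<^sup>2 \<partial>M) \<longlonglongrightarrow> 0"
proof -
  interpret finite_measure M by fact
  interpret L2: semi_inner_space "square_integrable M" "\<lambda>f g. \<integral>x. f x * g x \<partial>M"
    by (rule semi_inner_square_integrable)
  have one: "(\<lambda>_. 1) \<in> square_integrable M" by (simp add: square_integrable_def)
  have diff: "s k - s m \<in> square_integrable M" for k m using s by simp
  have sm [measurable]: "s n \<in> borel_measurable M" for n using s by (rule square_integrableD)
  have diff2: "integrable M (\<lambda>x. (s k x - s m x)\<^sup>2)" for k m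
    using integrable_square[OF diff, of k m] by simp
  have int1: "integrable M (s n)" for n
    using integrable_mult_square_integrable[OF s one, of n] by simp
  have L1: "(\<integral>x. \<bar>s k x - s m x\<bar> \<partial>M)\<^sup>2 \<le> (\<integral>x. (s k x - s m x)\<^sup>2 \<partial>M) * measure M (space M)" for k m
  proof -
    have "(\<lambda>x. \<bar>s k x - s m x\<bar>) \<in> square_integrable M"
      using diff2 by (simp add: square_integrable_def)
    from L2.Cauchy_Schwarz[OF this one] show ?thesis by (simp add: power2_eq_square)
  qed
  obtain r where r: "strict_mono r" and AEC: "AE x in M. Cauchy (\<lambda>i. s (r i) x)"
  proof (rule cauchy_L1_AE_cauchy_subseq[of M s, OF int1])
    fix e :: real assume e: "e > 0"
    \<comment> \<open>By Cauchy-Schwarz against the constant 1, a squared L^2 distance below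
      \<open>d\<close> gives an L^1 distance below \<open>e\<close>; the \<open>+ 1\<close> covers
      zero mass.\<close>
    define d where "d = e\<^sup>2 / (measure M (space M) + 1)"
    have m: "measure M (space M) + 1 > 0" by (simp add: add_nonneg_pos)
    then have "d > 0" using e by (simp add: d_def)
    then obtain N where N: "\<forall>k\<ge>N. \<forall>m\<ge>N. (\<integral>x. (s k x - s m x)\<^sup>2 \<partial>M) < d" using Cau[of d] by blast
    have "LINT x|M. norm (s i x - s j x) < e" if "i \<ge> N" "j \<ge> N" for i j
    proof -
      have "(\<integral>x. \<bar>s i x - s j x\<bar> \<partial>M)\<^sup>2 \<le> (\<integral>x. (s i x - s j x)\<^sup>2 \<partial>M) * (measure M (space M) + 1)"
        using L1[of i j] by (simp add: distrib_left add_increasing2)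
      also have "\<dots> < d * (measure M (space M) + 1)" using N that m by (intro mult_strict_right_mono) auto
      also have "\<dots> = e\<^sup>2" using m by (simp add: d_def)
      finally show ?thesis using e by (simp add: power2_less_imp_less)
    qed
    then show "\<exists>N. \<forall>i\<ge>N. \<forall>j\<ge>N. LINT x|M. norm (s i x - s j x) < e" by blast
  qed (rule that)
  define u where "u x = lim (\<lambda>i. s (r i) x)" for x
  have [measurable]: "u \<in> borel_measurable M" unfolding u_def by measurable
  have AEu: "AE x in M. (\<lambda>i. s (r i) x) \<longlonglongrightarrow> u x"
    using AEC by eventually_elim (auto simp: u_def Cauchy_convergent_iff convergent_LIMSEQ_iff)
  \<comment> \<open>Fatou's lemma along the subsequence; the index \<open>n\<close> remains in the
    full sequence, so the whole sequence converges.\<close>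
  have key: "(\<integral>\<^sup>+x. ennreal ((s n x - u x)\<^sup>2) \<partial>M) \<le> ennreal d"
    if N: "\<And>k m. k \<ge> N \<Longrightarrow> m \<ge> N \<Longrightarrow> (\<integral>x. (s k x - s m x)\<^sup>2 \<partial>M) < d" and n: "n \<ge> N" for n N d
  proof -
    have "(\<integral>\<^sup>+x. ennreal ((s n x - u x)\<^sup>2) \<partial>M) = (\<integral>\<^sup>+x. liminf (\<lambda>i. ennreal ((s n x - s (r i) x)\<^sup>2)) \<partial>M)"
    proof (rule nn_integral_cong_AE)
      show "AE x in M. ennreal ((s n x - u x)\<^sup>2) = liminf (\<lambda>i. ennreal ((s n x - s (r i) x)\<^sup>2))"
        using AEu
      proof eventually_elim
        case (elim x)
        then have "(\<lambda>i. ennreal ((s n x - s (r i) x)\<^sup>2)) \<longlonglongrightarrow> ennreal ((s n x - u x)\<^sup>2)"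
          by (intro tendsto_intros)
        then show ?case by (rule lim_imp_Liminf[OF trivial_limit_sequentially, symmetric])
      qed
    qed
    also have "\<dots> \<le> liminf (\<lambda>i. \<integral>\<^sup>+x. ennreal ((s n x - s (r i) x)\<^sup>2) \<partial>M)"
      by (rule nn_integral_liminf) measurable
    also have "\<dots> \<le> ennreal d"
    proof (rule Liminf_le)
      show "\<forall>\<^sub>F i in sequentially. (\<integral>\<^sup>+x. ennreal ((s n x - s (r i) x)\<^sup>2) \<partial>M) \<le> ennreal d"
        using eventually_ge_at_top[of N]
      proof eventually_elim
        case (elim i)
        then have "r i \<ge> N" using strict_mono_imp_increasing[OF r, of i] by simp
        from N[OF n this] show ?case
          by (subst nn_integral_eq_integral[OF diff2]) (auto intro: ennreal_leI)
      qed
    qed simp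
    finally show ?thesis .
  qed
  have int: "integrable M (\<lambda>x. (s n x - u x)\<^sup>2) \<and> (\<integral>x. (s n x - u x)\<^sup>2 \<partial>M) \<le> d"
    if N: "\<And>k m. k \<ge> N \<Longrightarrow> m \<ge> N \<Longrightarrow> (\<integral>x. (s k x - s m x)\<^sup>2 \<partial>M) < d" and n: "n \<ge> N" and d: "d > 0" for n N d
  proof
    have 1: "(\<integral>\<^sup>+x. ennreal ((s n x - u x)\<^sup>2) \<partial>M) \<le> ennreal d" by (rule key[OF N n])
    then have "(\<integral>\<^sup>+x. ennreal ((s n x - u x)\<^sup>2) \<partial>M) < \<infinity>" by (simp add: le_less_trans)
    then show "integrable M (\<lambda>x. (s n x - u x)\<^sup>2)" by (intro integrableI_nonneg) auto
    then show "(\<integral>x. (s n x - u x)\<^sup>2 \<partial>M) \<le> d"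
      using 1 d by (simp add: nn_integral_eq_integral ennreal_le_iff)
  qed
  have "u \<in> square_integrable M"
  proof -
    obtain N where "\<And>k m. k \<ge> N \<Longrightarrow> m \<ge> N \<Longrightarrow> (\<integral>x. (s k x - s m x)\<^sup>2 \<partial>M) < 1"
      using Cau[of 1] by auto
    from int[OF this order_refl] have "s N - u \<in> square_integrable M"
      by (simp add: square_integrable_def fun_diff_def)
    from L2.closed(2)[OF s[of N] this] show ?thesis by simp
  qed
  moreover have "(\<lambda>n. \<integral>x. (s n x - u x)\<^sup>2 \<partial>M) \<longlonglongrightarrow> 0"
  proof (rule LIMSEQ_I)
    fix e :: real assume e: "e > 0"
    then obtain N where N: "\<And>k m. k \<ge> N \<Longrightarrow> m \<ge> N \<Longrightarrow> (\<integral>x. (s k x - s m x)\<^sup>2 \<partial>M) < e/2"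
      using Cau[of "e/2"] by auto
    have "norm ((\<integral>x. (s n x - u x)\<^sup>2 \<partial>M) - 0) < e" if "n \<ge> N" for n
      using int[OF N that] e by simp
    then show "\<exists>N. \<forall>n\<ge>N. norm ((\<integral>x. (s n x - u x)\<^sup>2 \<partial>M) - 0) < e" by blast
  qed
  ultimately show ?thesis by blast
qed

text \<open>Cut \<open>h\<close> at a height \<open>n\<close>: the high part \<open>t n\<close> has
  L^2 norm below 1/2 and is handled by Cauchy-Schwarz, the rest is bounded by \<open>n\<close> and
  pairs with the L^1 norm of \<open>f\<close>. Each part contributes at most 1/2.\<close>

lemma L1_small_imp_weakly_small:
  assumes h: "h \<in> square_integrable M"
  obtains \<delta> where "\<delta> > 0" "\<And>f. f \<in> square_integrable M \<Longrightarrow> integrable M f \<Longrightarrow>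
    (\<integral>x. f x * f x \<partial>M) \<le> 1 \<Longrightarrow> (\<integral>x. \<bar>f x\<bar> \<partial>M) \<le> \<delta> \<Longrightarrow> \<bar>\<integral>x. f x * h x \<partial>M\<bar> \<le> 1"
proof -
  interpret L2: semi_inner_space "square_integrable M" "\<lambda>f g. \<integral>x. f x * g x \<partial>M"
    by (rule semi_inner_square_integrable)
  have [measurable]: "h \<in> borel_measurable M" using h by (rule square_integrableD)
  define t where "t n x = (if real n < \<bar>h x\<bar> then h x else 0)" for n x
  have [measurable]: "t n \<in> borel_measurable M" for n unfolding t_def by measurable
  have "(\<lambda>n. \<integral>x. (t n x)\<^sup>2 \<partial>M) \<longlonglongrightarrow> (\<integral>x. 0 \<partial>M)"
  proof (rule integral_dominated_convergence[where w="\<lambda>x. (h x)\<^sup>2"])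
    show "AE x in M. (\<lambda>n. (t n x)\<^sup>2) \<longlonglongrightarrow> 0"
    proof (rule AE_I2)
      fix x
      obtain N where N: "\<bar>h x\<bar> < real N" using reals_Archimedean2 by blast
      have "\<forall>\<^sub>F n in sequentially. (t n x)\<^sup>2 = 0"
        using eventually_ge_at_top[of N] by eventually_elim (use N in \<open>auto simp: t_def\<close>)
      then show "(\<lambda>n. (t n x)\<^sup>2) \<longlonglongrightarrow> 0" by (rule tendsto_eventually)
    qed
    show "integrable M (\<lambda>x. (h x)\<^sup>2)" by (rule integrable_square[OF h])
  qed (auto simp: t_def)
  then have "\<forall>\<^sub>F n in sequentially. (\<integral>x. (t n x)\<^sup>2 \<partial>M) < 1/4" by (intro order_tendstoD(2)) auto
  then obtain n where n: "(\<integral>x. (t n x)\<^sup>2 \<partial>M) < 1/4" by (auto simp: eventually_sequentially)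
  have tL: "t n \<in> square_integrable M"
  proof -
    have "integrable M (\<lambda>x. (t n x)\<^sup>2)"
      by (rule Bochner_Integration.integrable_bound[OF integrable_square[OF h]]) (auto simp: t_def)
    then show ?thesis by (simp add: square_integrable_def)
  qed
  show thesis
  proof (rule that[of "1 / (2 * (real n + 1))"])
    fix f assume f: "f \<in> square_integrable M" and fi: "integrable M f"
      and f2: "(\<integral>x. f x * f x \<partial>M) \<le> 1" and f1: "(\<integral>x. \<bar>f x\<bar> \<partial>M) \<le> 1 / (2 * (real n + 1))"
    have [measurable]: "f \<in> borel_measurable M" using f by (rule square_integrableD)
    have "\<bar>\<integral>x. f x * t n x \<partial>M\<bar> \<le> sqrt (\<integral>x. f x * f x \<partial>M) * sqrt (\<integral>x. t n x * t n x \<partial>M)"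
      by (rule L2.abs_le_sqrt[OF f tL])
    also have "\<dots> \<le> 1 * sqrt (1/4)"
      using f2 n by (intro mult_mono real_sqrt_le_mono) (auto simp: power2_eq_square real_sqrt_ge_0_iff intro: integral_nonneg)
    finally have 1: "\<bar>\<integral>x. f x * t n x \<partial>M\<bar> \<le> 1/2" by (simp add: real_sqrt_divide)
    have dL: "h - t n \<in> square_integrable M" using h tL by simp
    have int: "integrable M (\<lambda>x. f x * (h x - t n x))"
      using integrable_mult_square_integrable[OF f dL] by simp
    have "\<bar>\<integral>x. f x * (h x - t n x) \<partial>M\<bar> \<le> (\<integral>x. \<bar>f x * (h x - t n x)\<bar> \<partial>M)" by simp
    also have "\<dots> \<le> (\<integral>x. real n * \<bar>f x\<bar> \<partial>M)"
    proof (rule integral_mono)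
      show "\<bar>f x * (h x - t n x)\<bar> \<le> real n * \<bar>f x\<bar>" for x
        unfolding abs_mult by (subst mult.commute, intro mult_right_mono) (auto simp: t_def)
    qed (use int fi in auto)
    also have "\<dots> \<le> real n * (1 / (2 * (real n + 1)))" using f1 by (simp add: mult_left_mono del: times_divide_eq_right)
    also have "\<dots> \<le> 1/2" by (simp add: field_simps)
    finally have 2: "\<bar>\<integral>x. f x * (h x - t n x) \<partial>M\<bar> \<le> 1/2" .
    have "(\<integral>x. f x * h x \<partial>M) = (\<integral>x. f x * t n x + f x * (h x - t n x) \<partial>M)" by (simp add: algebra_simps)
    also have "\<dots> = (\<integral>x. f x * t n x \<partial>M) + (\<integral>x. f x * (h x - t n x) \<partial>M)"
      by (rule Bochner_Integration.integral_add[OF integrable_mult_square_integrable[OF f tL] int])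
    finally show "\<bar>\<integral>x. f x * h x \<partial>M\<bar> \<le> 1" using 1 2 by linarith
  qed simp
qed

section \<open>Test functions and integration by parts\<close>

text \<open>\<open>partial\<close> has a value even where no derivative exists; this relation also
  asserts existence, so differentiation rules can be chained.\<close>

definition has_partial :: "'n::finite \<Rightarrow> (real^'n \<Rightarrow> real) \<Rightarrow> (real^'n \<Rightarrow> real) \<Rightarrow> bool" where
  "has_partial i f f' \<longleftrightarrow> (\<forall>x. ((\<lambda>t. f (x + t *\<^sub>R axis i 1)) has_real_derivative f' x) (at 0))"

lemma has_partial_imp_partial: "has_partial i f f' \<Longrightarrow> partial i f = f'"
  unfolding has_partial_def partial_def by (auto intro!: DERIV_imp_deriv)

lemma has_partial_at:
  assumes "has_partial i f f'"
  shows "((\<lambda>t. f (x + t *\<^sub>R axis i 1)) has_real_derivative f' (x + s *\<^sub>R axis i 1)) (at s)"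
proof -
  have "((\<lambda>t. f (x + s *\<^sub>R axis i 1 + t *\<^sub>R axis i 1)) has_real_derivative f' (x + s *\<^sub>R axis i 1)) (at 0)"
    using assms by (simp add: has_partial_def)
  then show ?thesis
    using DERIV_shift[of "\<lambda>t. f (x + t *\<^sub>R axis i 1)" "f' (x + s *\<^sub>R axis i 1)" 0 s]
    by (simp add: algebra_simps)
qed

lemma has_partial_lincomb:
  "has_partial i f f' \<Longrightarrow> has_partial i g g' \<Longrightarrow> has_partial i (\<lambda>x. a * f x + b * g x) (\<lambda>x. a * f' x + b * g' x)"
  unfolding has_partial_def by (auto intro!: derivative_eq_intros)

lemma has_partial_mult:
  "has_partial i f f' \<Longrightarrow> has_partial i g g' \<Longrightarrow> has_partial i (\<lambda>x. f x * g x) (\<lambda>x. f' x * g x + f x * g' x)"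
  unfolding has_partial_def by (auto intro!: derivative_eq_intros)

lemma has_partial_exp_minus:
  "has_partial i f f' \<Longrightarrow> has_partial i (\<lambda>x. exp (- f x)) (\<lambda>x. - f' x * exp (- f x))"
  unfolding has_partial_def by (auto intro!: derivative_eq_intros)

section \<open>Smooth functions and the space of test functions\<close>

lemma smooth_fun_iter_partial: "smooth_fun f \<Longrightarrow> continuous_on UNIV (iter_partial is f)"
  by (simp add: smooth_fun_def)

lemma smooth_fun_has_partial_iter:
  "smooth_fun f \<Longrightarrow> has_partial i (iter_partial is f) (partial i (iter_partial is f))"
  unfolding smooth_fun_def has_partial_def partial_def
  by (auto simp: DERIV_deriv_iff_real_differentiable)

lemma smooth_fun_continuous: "smooth_fun f \<Longrightarrow> continuous_on UNIV f"
  using smooth_fun_iter_partial[of f "[]"] by (simp add: iter_partial_def)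

lemma smooth_fun_has_partial: "smooth_fun f \<Longrightarrow> has_partial i f (partial i f)"
  using smooth_fun_has_partial_iter[of f i "[]"] by (simp add: iter_partial_def)

lemma smooth_fun_partial:
  assumes "smooth_fun f" shows "smooth_fun (partial i f)"
proof -
  have "iter_partial is (partial i f) = iter_partial (is @ [i]) f" for "is"
    by (simp add: iter_partial_def)
  then show ?thesis using assms by (simp only: smooth_fun_def simp_thms)
qed

lemma iter_partial_lincomb:
  assumes f: "smooth_fun f" and g: "smooth_fun g"
  shows "iter_partial is (\<lambda>x. a * f x + b * g x) = (\<lambda>x. a * iter_partial is f x + b * iter_partial is g x)"
proof (induction "is")
  case Nil then show ?case by (simp add: iter_partial_def)
next
  case (Cons i "is")
  have "iter_partial (i # is) (\<lambda>x. a * f x + b * g x) = partial i (iter_partial is (\<lambda>x. a * f x + b * g x))"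
    by (simp add: iter_partial_def)
  also have "\<dots> = (\<lambda>x. a * partial i (iter_partial is f) x + b * partial i (iter_partial is g) x)"
    unfolding Cons
    by (intro has_partial_imp_partial has_partial_lincomb smooth_fun_has_partial_iter f g)
  finally show ?case by (simp add: iter_partial_def)
qed

lemma smooth_fun_lincomb:
  assumes f: "smooth_fun f" and g: "smooth_fun g"
  shows "smooth_fun (\<lambda>x. a * f x + b * g x)"
  unfolding smooth_fun_def iter_partial_lincomb[OF f g]
  using assms by (auto simp: smooth_fun_def intro!: continuous_intros derivative_intros)

lemma iter_partial_zero: "iter_partial is (\<lambda>x. 0) = (\<lambda>x. 0)"
proof (induction "is")
  case (Cons i "is")
  have "has_partial i (\<lambda>x. 0) (\<lambda>x. 0)" by (simp add: has_partial_def)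
  then show ?case using Cons by (simp add: iter_partial_def has_partial_imp_partial)
qed (simp add: iter_partial_def)

lemma subspace_test_fun: "subspace {f :: real^'n::finite \<Rightarrow> real. test_fun f}"
proof -
  have lc: "test_fun (\<lambda>x. a * f x + b * g x)" if f: "test_fun f" and g: "test_fun g" for f g :: "real^'n \<Rightarrow> real" and a b
  proof -
    have "{x. a * f x + b * g x \<noteq> 0} \<subseteq> {x. f x \<noteq> 0} \<union> {x. g x \<noteq> 0}" by auto
    moreover have "bounded ({x. f x \<noteq> 0} \<union> {x. g x \<noteq> 0})"
      using f g by (simp add: test_fun_def compact_closure)
    ultimately have "compact (closure {x. a * f x + b * g x \<noteq> 0})"
      using bounded_subset compact_closure by blast
    then show ?thesis using f g by (simp add: test_fun_def smooth_fun_lincomb)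
  qed
  have "test_fun (\<lambda>x::real^'n. 0)" by (simp add: test_fun_def smooth_fun_def iter_partial_zero)
  moreover have "test_fun (f + g)" if "test_fun f" "test_fun g" for f g :: "real^'n \<Rightarrow> real"
    using lc[OF that, of 1 1] by (simp add: plus_fun_def)
  moreover have "test_fun (\<lambda>x. r * f x)" if "test_fun f" for f :: "real^'n \<Rightarrow> real" and r
    using lc[OF that that, of r 0] by simp
  ultimately show ?thesis
    by (simp add: subspace_def zero_fun_def scaleR_fun_def)
qed

text \<open>Continuity in place of smoothness makes the class stable under multiplication by any
  continuous function, such as \<open>exp (- V x)\<close> or a derivative of
  \<open>V\<close>.\<close>

definition compactly_supported :: "(real^'n::finite \<Rightarrow> real) \<Rightarrow> bool" where
  "compactly_supported f \<longleftrightarrow> continuous_on UNIV f \<and> bounded {x. f x \<noteq> 0}"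

lemma test_fun_compactly_supported: "test_fun f \<Longrightarrow> compactly_supported f"
  by (simp add: test_fun_def compactly_supported_def smooth_fun_continuous compact_closure)

lemma compactly_supported_partial:
  assumes "test_fun f" shows "compactly_supported (partial i f)"
proof -
  have "{x. partial i f x \<noteq> 0} \<subseteq> closure {x. f x \<noteq> 0}"
  proof
    fix x assume x: "x \<in> {x. partial i f x \<noteq> 0}"
    show "x \<in> closure {x. f x \<noteq> 0}"
    proof (rule ccontr)
      assume nx: "x \<notin> closure {x. f x \<noteq> 0}"
      define U where "U = (\<lambda>t::real. x + t *\<^sub>R axis i 1) -` (- closure {x. f x \<noteq> 0})"
      have U: "open U" unfolding U_def
        by (intro open_vimage continuous_intros) auto
      have U0: "0 \<in> U" using nx by (simp add: U_def)
      have d0: "((\<lambda>t::real. 0::real) has_real_derivative 0) (at 0)" by simp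
      have eq: "0 = f (x + t *\<^sub>R axis i 1)" if "t \<in> U" for t
      proof -
        have "x + t *\<^sub>R axis i 1 \<notin> {x. f x \<noteq> 0}"
          by (rule contra_subsetD[OF closure_subset]) (use that in \<open>simp add: U_def\<close>)
        then show ?thesis by simp
      qed
      have "((\<lambda>t. f (x + t *\<^sub>R axis i 1)) has_real_derivative 0) (at 0)"
        by (rule has_field_derivative_transform_within_open[OF d0 U U0 eq])
      then have "partial i f x = 0" unfolding partial_def by (rule DERIV_imp_deriv)
      then show False using x by simp
    qed
  qed
  moreover have "bounded (closure {x. f x \<noteq> 0})"
    using assms unfolding test_fun_def by (blast intro: compact_imp_bounded)
  ultimately have "bounded {x. partial i f x \<noteq> 0}" using bounded_subset by blast
  then show ?thesis
    using assms by (simp add: test_fun_def compactly_supported_def smooth_fun_continuous smooth_fun_partial)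
qed

lemma compactly_supported_mult:
  assumes f: "compactly_supported f" and g: "continuous_on UNIV g"
  shows "compactly_supported (\<lambda>x. f x * g x)"
proof -
  have "{x. f x * g x \<noteq> 0} \<subseteq> {x. f x \<noteq> 0}" by auto
  moreover have "bounded {x. f x \<noteq> 0}" using f by (simp add: compactly_supported_def)
  ultimately have "bounded {x. f x * g x \<noteq> 0}" using bounded_subset by blast
  then show ?thesis using f g by (simp add: compactly_supported_def continuous_on_mult)
qed

lemma compactly_supported_mult':
  assumes "continuous_on UNIV g" "compactly_supported f"
  shows "compactly_supported (\<lambda>x. g x * f x)"
  using compactly_supported_mult[OF assms(2,1)] by (simp add: mult.commute)

lemma compactly_supported_add:
  assumes "compactly_supported f" "compactly_supported g"
  shows "compactly_supported (\<lambda>x. f x + g x)"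
proof -
  have "{x. f x + g x \<noteq> 0} \<subseteq> {x. f x \<noteq> 0} \<union> {x. g x \<noteq> 0}" by auto
  moreover have "bounded ({x. f x \<noteq> 0} \<union> {x. g x \<noteq> 0})"
    using assms by (simp add: compactly_supported_def)
  ultimately have "bounded {x. f x + g x \<noteq> 0}" using bounded_subset by blast
  then show ?thesis using assms by (simp add: compactly_supported_def continuous_on_add)
qed

lemma compactly_supported_diff:
  assumes "compactly_supported f" "compactly_supported g"
  shows "compactly_supported (\<lambda>x. f x - g x)"
  using compactly_supported_add[OF assms(1) compactly_supported_mult'[OF continuous_on_const assms(2), of "-1"]]
  by simp

lemma compactly_supported_sum:
  "(\<And>i. i \<in> I \<Longrightarrow> compactly_supported (f i)) \<Longrightarrow> compactly_supported (\<lambda>x. \<Sum>i\<in>I. f i x)"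
proof (induction I rule: infinite_finite_induct)
  case (insert i I)
  then show ?case by (simp add: compactly_supported_add)
qed (simp_all add: compactly_supported_def)

lemma compactly_supported_borel: "compactly_supported f \<Longrightarrow> f \<in> borel_measurable borel"
  unfolding compactly_supported_def by (simp add: borel_measurable_continuous_onI)

lemma compactly_supported_cball:
  assumes "compactly_supported f"
  obtains R where "R > 0" "\<And>x. norm x > R \<Longrightarrow> f x = 0"
proof -
  obtain R where "R > 0" "\<forall>x\<in>{x. f x \<noteq> 0}. norm x \<le> R"
    using assms unfolding compactly_supported_def bounded_pos by blast
  then show thesis using that[of R] by force
qed

lemma compactly_supported_bounded:
  assumes f: "compactly_supported f"
  obtains B where "B > 0" "\<And>x. \<bar>f x\<bar> \<le> B"
proof -
  obtain R where R: "R > 0" "\<And>x. norm x > R \<Longrightarrow> f x = 0"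
    by (rule compactly_supported_cball[OF f]) (rule that)
  have "compact (f ` cball 0 R)"
    using f unfolding compactly_supported_def
    by (intro compact_continuous_image) (auto intro: continuous_on_subset)
  then have "bounded (f ` cball 0 R)" by (rule compact_imp_bounded)
  then obtain B where "B > 0" "\<forall>y\<in>f ` cball 0 R. norm y \<le> B" unfolding bounded_pos by blast
  then have B: "B > 0" "\<And>x. x \<in> cball 0 R \<Longrightarrow> \<bar>f x\<bar> \<le> B" by auto
  have "\<bar>f x\<bar> \<le> B" for x
    using B(2)[of x] R(2)[of x] B(1) by (cases "norm x > R") (auto simp: less_imp_le)
  then show thesis using that B by blast
qed

lemma compactly_supported_integrable:
  assumes f: "compactly_supported f"
  shows "integrable lborel f"
proof -
  obtain R where R: "R > 0" "\<And>x. norm x > R \<Longrightarrow> f x = 0"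
    by (rule compactly_supported_cball[OF f]) (rule that)
  have "integrable lborel (\<lambda>x. indicator (cball 0 R) x *\<^sub>R f x)"
    using f unfolding compactly_supported_def
    by (intro borel_integrable_compact) (auto intro: continuous_on_subset)
  moreover have "(\<lambda>x. indicator (cball 0 R) x *\<^sub>R f x) = f"
    using R(2) by (auto simp: fun_eq_iff indicator_def not_le)
  ultimately show ?thesis by simp
qed

text \<open>Translation invariance of Lebesgue measure makes every difference quotient integrate to zero.\<close>
lemma integral_partial_eq_0:
  assumes F: "compactly_supported F" and F': "compactly_supported F'" and hp: "has_partial i F F'"
  shows "(\<integral>x. F' x \<partial>lborel) = 0"
proof -
  define h where "h n = inverse (real (Suc n))" for n
  have h: "0 < h n" "h n \<le> 1" for n by (auto simp: h_def inverse_le_1_iff)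
  have hlim: "h \<longlonglongrightarrow> 0" unfolding h_def by (rule LIMSEQ_inverse_real_of_nat)
  define q where "q n x = (F (x + h n *\<^sub>R axis i 1) - F x) / h n" for n x
  obtain B where B: "B > 0" "\<And>x. \<bar>F' x\<bar> \<le> B" using compactly_supported_bounded[OF F'] by blast
  obtain R where R: "R > 0" "\<And>x. norm x > R \<Longrightarrow> F x = 0" using compactly_supported_cball[OF F] by blast
  have mF [measurable]: "F \<in> borel_measurable borel" by (rule compactly_supported_borel[OF F])
  have mF' [measurable]: "F' \<in> borel_measurable borel" by (rule compactly_supported_borel[OF F'])
  have intF: "integrable lborel F" by (rule compactly_supported_integrable[OF F])
  have shift: "integrable lborel (\<lambda>x. F (x + c))" "(\<integral>x. F (x + c) \<partial>lborel) = (\<integral>x. F x \<partial>lborel)" for c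
  proof -
    have "integrable (distr lborel borel ((+) c)) F" using intF by (simp add: lborel_distr_plus)
    then show "integrable lborel (\<lambda>x. F (x + c))" by (subst (asm) integrable_distr_eq) (auto simp: add.commute)
    have "(\<integral>x. F x \<partial>lborel) = (\<integral>x. F x \<partial>distr lborel borel ((+) c))" by (simp add: lborel_distr_plus)
    also have "\<dots> = (\<integral>x. F (x + c) \<partial>lborel)" by (subst integral_distr) (auto simp: add.commute)
    finally show "(\<integral>x. F (x + c) \<partial>lborel) = (\<integral>x. F x \<partial>lborel)" by simp
  qed
  have q0: "(\<integral>x. q n x \<partial>lborel) = 0" for n
    unfolding q_def using shift intF by (simp add: Bochner_Integration.integral_diff)
  have "(\<lambda>n. \<integral>x. q n x \<partial>lborel) \<longlonglongrightarrow> (\<integral>x. F' x \<partial>lborel)"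
  \<comment> \<open>As \<open>h n \<le> 1\<close>, the quotient vanishes outside radius
    \<open>R + 1\<close>; inside, the mean value theorem makes it a value of
    \<open>F'\<close>.\<close>
  proof (rule integral_dominated_convergence[where w="\<lambda>x. indicator (cball 0 (R + 1)) x *\<^sub>R B"])
    show "F' \<in> borel_measurable lborel" using mF' by simp
    show "q n \<in> borel_measurable lborel" for n unfolding q_def by simp
    show "integrable lborel (\<lambda>x::real^'a. indicator (cball 0 (R + 1)) x *\<^sub>R B)"
      by (intro borel_integrable_compact) auto
    show "AE x in lborel. (\<lambda>n. q n x) \<longlonglongrightarrow> F' x"
    proof (rule AE_I2)
      fix x
      have "((\<lambda>t. (F (x + t *\<^sub>R axis i 1) - F x) / t) \<longlongrightarrow> F' x) (at 0)"
        using hp by (simp add: has_partial_def has_field_derivative_iff)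
      moreover have "filterlim h (at 0) sequentially"
        using hlim h(1) by (auto simp: filterlim_at less_imp_neq[symmetric] intro!: always_eventually)
      ultimately show "(\<lambda>n. q n x) \<longlonglongrightarrow> F' x"
        unfolding q_def by (rule filterlim_compose)
    qed
    show "AE x in lborel. norm (q n x) \<le> indicator (cball 0 (R + 1)) x *\<^sub>R B" for n
    proof (rule AE_I2)
      fix x
      show "norm (q n x) \<le> indicator (cball 0 (R + 1)) x *\<^sub>R B"
      proof (cases "norm x \<le> R + 1")
        case True
        have "\<exists>z::real. z > 0 \<and> z < h n \<and> F (x + h n *\<^sub>R axis i 1) - F (x + 0 *\<^sub>R axis i 1)
            = (h n - 0) * F' (x + z *\<^sub>R axis i 1)"
          by (rule MVT2) (use h has_partial_at[OF hp] in auto)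
        then obtain z where "F (x + h n *\<^sub>R axis i 1) - F x = h n * F' (x + z *\<^sub>R axis i 1)" by auto
        then have "q n x = F' (x + z *\<^sub>R axis i 1)" using h[of n] by (simp add: q_def)
        then show ?thesis using B True by simp
      next
        case False
        have "norm x \<le> norm (x + h n *\<^sub>R axis i 1) + norm (h n *\<^sub>R axis i 1 :: real^'a)"
          by (metis add_diff_cancel_right' norm_triangle_ineq4)
        moreover have "norm (h n *\<^sub>R axis i 1 :: real^'a) \<le> 1" using h[of n] by (simp add: norm_axis_1)
        ultimately have "norm (x + h n *\<^sub>R axis i 1) > R" "norm x > R" using False by auto
        then show ?thesis using R(2) False by (simp add: q_def)
      qed
    qed
  qed
  then show ?thesis by (simp add: q0 LIMSEQ_const_iff)
qed

lemma grad_nth: "grad f x $ i = partial i f x" by (simp add: grad_def)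

lemma compactly_supported_grad_inner:
  assumes "test_fun \<phi>" "test_fun \<psi>"
  shows "compactly_supported (\<lambda>x. grad \<phi> x \<bullet> grad \<psi> x)"
proof -
  have "compactly_supported (\<lambda>x. \<Sum>i\<in>UNIV. partial i \<phi> x * partial i \<psi> x)"
    using assms by (intro compactly_supported_sum compactly_supported_mult compactly_supported_partial smooth_fun_continuous smooth_fun_partial)
      (simp_all add: test_fun_def)
  then show ?thesis by (simp add: inner_vec_def grad_nth)
qed

lemma test_fun_partial: 
  assumes "test_fun f" shows "test_fun (partial i f)"
proof -
  have "compact (closure {x. partial i f x \<noteq> 0})"
    using compactly_supported_partial[OF assms, of i]
    by (auto simp: compactly_supported_def compact_eq_bounded_closed bounded_closure)
  then show ?thesis using assms by (simp add: test_fun_def smooth_fun_partial)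
qed

lemma compactly_supported_genL:
  assumes V: "smooth_fun V" and \<psi>: "test_fun \<psi>"
  shows "compactly_supported (genL V \<psi>)"
proof -
  have supp: "compactly_supported (partial i \<psi>)" "compactly_supported (partial j (partial i \<psi>))" for i j
    using \<psi> by (simp_all add: test_fun_partial compactly_supported_partial)
  have cont: "continuous_on UNIV (partial i V)" for i
    by (rule smooth_fun_continuous[OF smooth_fun_partial[OF V]])
  have "compactly_supported (\<lambda>x. (\<Sum>i\<in>UNIV. partial i (partial i \<psi>) x) - (\<Sum>i\<in>UNIV. partial i V x * partial i \<psi> x))"
    by (intro compactly_supported_diff compactly_supported_sum compactly_supported_mult' supp cont)
  moreover have "genL V \<psi> = (\<lambda>x. (\<Sum>i\<in>UNIV. partial i (partial i \<psi>) x) - (\<Sum>i\<in>UNIV. partial i V x * partial i \<psi> x))"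
    by (simp add: fun_eq_iff genL_def laplacian_def inner_vec_def grad_nth)
  ultimately show ?thesis by simp
qed

lemma integration_by_parts:
  assumes V: "smooth_fun V" and \<phi>: "test_fun \<phi>" and \<psi>: "test_fun \<psi>"
  shows "(\<integral>x. exp (- V x) * (grad \<phi> x \<bullet> grad \<psi> x) \<partial>lborel) = (\<integral>x. exp (- V x) * (\<phi> x * - genL V \<psi> x) \<partial>lborel)"
proof -
  have cV: "continuous_on UNIV (\<lambda>x. exp (- V x))"
    using smooth_fun_continuous[OF V] by (intro continuous_intros)
  \<comment> \<open>\<open>G i\<close> is the \<open>i\<close>-th partial derivative of
    \<open>\<phi> x * partial i \<psi> x * exp (- V x)\<close>; the sum over \<open>i\<close> is the
    divergence of a compactly supported field.\<close>
  define G where "G i x = (partial i \<phi> x * partial i \<psi> x + \<phi> x * partial i (partial i \<psi>) x) * exp (- V x)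
      + (\<phi> x * partial i \<psi> x) * (- partial i V x * exp (- V x))" for i x
  have s: "smooth_fun \<phi>" "smooth_fun \<psi>" using \<phi> \<psi> by (auto simp: test_fun_def)
  have supp: "compactly_supported \<phi>" "compactly_supported (partial i \<phi>)" for i
    using \<phi> by (auto intro: test_fun_compactly_supported compactly_supported_partial)
  have cont: "continuous_on UNIV (partial i V)" "continuous_on UNIV (partial i \<psi>)"
    "continuous_on UNIV (partial j (partial i \<psi>))" for i j
    by (intro smooth_fun_continuous smooth_fun_partial V s)+
  have cs: "compactly_supported (G i)" for i
    unfolding G_def
    by (intro compactly_supported_add compactly_supported_mult supp cont cV continuous_on_mult continuous_on_minus)
  have G0: "(\<integral>x. G i x \<partial>lborel) = 0" for i
  proof (rule integral_partial_eq_0[OF _ cs])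
    show "has_partial i (\<lambda>x. (\<phi> x * partial i \<psi> x) * exp (- V x)) (G i)"
      unfolding G_def by (intro has_partial_mult has_partial_exp_minus smooth_fun_has_partial s V smooth_fun_partial)
    show "compactly_supported (\<lambda>x. (\<phi> x * partial i \<psi> x) * exp (- V x))"
      by (intro compactly_supported_mult supp cont cV)
  qed
  have "(\<integral>x. (\<Sum>i\<in>UNIV. G i x) \<partial>lborel) = 0"
    by (subst Bochner_Integration.integral_sum) (auto intro: compactly_supported_integrable cs simp: G0)
  moreover have "(\<Sum>i\<in>UNIV. G i x) = exp (- V x) * (grad \<phi> x \<bullet> grad \<psi> x) - exp (- V x) * (\<phi> x * - genL V \<psi> x)" for x
    by (simp add: G_def genL_def laplacian_def inner_vec_def grad_nth sum_distrib_left sum.distrib sum_subtractf sum_negf algebra_simps)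
  moreover have "integrable lborel (\<lambda>x. exp (- V x) * (grad \<phi> x \<bullet> grad \<psi> x))"
    by (intro compactly_supported_integrable compactly_supported_mult' cV compactly_supported_grad_inner \<phi> \<psi>)
  moreover have "integrable lborel (\<lambda>x. exp (- V x) * (\<phi> x * - genL V \<psi> x))"
    using compactly_supported_genL[OF V \<psi>] unfolding compactly_supported_def[of "genL V \<psi>"]
    by (intro compactly_supported_integrable compactly_supported_mult' cV compactly_supported_mult[OF test_fun_compactly_supported[OF \<phi>]] continuous_on_minus) auto
  ultimately show ?thesis by simp
qed

section \<open>The weighted Laplacian\<close>

locale smooth_potential =
  fixes V :: "real^'n \<Rightarrow> real"
  assumes smooth_V: "smooth_fun V"
    and integrable_exp_V: "integrable lborel (\<lambda>x. exp (- V x))"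
begin

abbreviation H :: "(real^'n \<Rightarrow> real) set" where "H \<equiv> square_integrable (mu V)"
abbreviation D :: "(real^'n \<Rightarrow> real) set" where "D \<equiv> {f. test_fun f}"

definition ip :: "(real^'n \<Rightarrow> real) \<Rightarrow> (real^'n \<Rightarrow> real) \<Rightarrow> real" where
  "ip f g = (\<integral>x. f x * g x \<partial>mu V)"

definition energy :: "(real^'n \<Rightarrow> real) \<Rightarrow> (real^'n \<Rightarrow> real) \<Rightarrow> real" where
  "energy f g = (\<integral>x. grad f x \<bullet> grad g x \<partial>mu V)"

lemma sets_mu: "sets (mu V) = sets borel"
  by (simp add: mu_def)

lemma borel_measurable_mu: "f \<in> borel_measurable (mu V) \<longleftrightarrow> f \<in> borel_measurable borel"
  by (rule iffD1[OF refl], subst measurable_cong_sets[OF sets_mu refl], rule refl)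

lemma borel_measurable_V [measurable]: "V \<in> borel_measurable borel"
  by (rule borel_measurable_continuous_onI[OF smooth_fun_continuous[OF smooth_V]])

lemma Zc_nonneg: "0 \<le> Zc V"
  unfolding Zc_def by simp

lemma integral_mu:
  fixes f :: "real^'n \<Rightarrow> real"
  assumes [measurable]: "f \<in> borel_measurable borel"
  shows "(\<integral>x. f x \<partial>mu V) = (\<integral>x. exp (- V x) * f x \<partial>lborel) / Zc V"
proof -
  have "(\<integral>x. f x \<partial>mu V) = (\<integral>x. (exp (- V x) / Zc V) *\<^sub>R f x \<partial>lborel)"
    unfolding mu_def by (rule integral_density) (auto simp: Zc_nonneg)
  also have "\<dots> = (\<integral>x. (exp (- V x) * f x) / Zc V \<partial>lborel)" by simp
  finally show ?thesis by (simp only: integral_divide_zero)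
qed

sublocale finite_measure "mu V"
proof
  have "integrable lborel (\<lambda>x. exp (- V x) / Zc V)" using integrable_exp_V by simp
  then have "(\<integral>\<^sup>+x. ennreal (exp (- V x) / Zc V) \<partial>lborel) < \<infinity>"
    using Zc_nonneg unfolding integrable_iff_bounded by simp
  then show "emeasure (mu V) (space (mu V)) \<noteq> \<infinity>"
    unfolding mu_def by (subst emeasure_density) auto
qed

lemma compactly_supported_integrable_mu:
  assumes f: "compactly_supported f" shows "integrable (mu V) f"
proof -
  obtain B where "\<And>x. \<bar>f x\<bar> \<le> B" by (rule compactly_supported_bounded[OF f]) (rule that)
  then show ?thesis
    using compactly_supported_borel[OF f]
    by (intro integrable_const_bound[of _ B]) (auto simp: borel_measurable_mu)
qed

lemma compactly_supported_in_H:
  assumes f: "compactly_supported f" shows "f \<in> H"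
proof -
  have "compactly_supported (\<lambda>x. f x * f x)"
    by (rule compactly_supported_mult[OF f]) (use f in \<open>simp add: compactly_supported_def\<close>)
  from compactly_supported_integrable_mu[OF this] show ?thesis
    using compactly_supported_borel[OF f] by (simp add: square_integrable_def borel_measurable_mu power2_eq_square)
qed

lemma L2mu_iff: "L2mu V f \<longleftrightarrow> f \<in> H"
  by (simp add: L2mu_def square_integrable_def borel_measurable_mu)

lemma test_fun_in_H: "test_fun f \<Longrightarrow> f \<in> H"
  by (intro compactly_supported_in_H test_fun_compactly_supported)

lemma grad_add: "test_fun f \<Longrightarrow> test_fun g \<Longrightarrow> grad (f + g) x = grad f x + grad g x"
proof -
  assume "test_fun f" "test_fun g"
  then have "partial i (\<lambda>x. 1 * f x + 1 * g x) = (\<lambda>x. 1 * partial i f x + 1 * partial i g x)" for i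
    by (intro has_partial_imp_partial has_partial_lincomb smooth_fun_has_partial) (auto simp: test_fun_def)
  then show ?thesis by (simp add: vec_eq_iff grad_nth plus_fun_def)
qed

lemma grad_scaleR: "test_fun f \<Longrightarrow> grad (r *\<^sub>R f) x = r *\<^sub>R grad f x"
proof -
  assume "test_fun f"
  then have "partial i (\<lambda>x. r * f x + 0 * f x) = (\<lambda>x. r * partial i f x + 0 * partial i f x)" for i
    by (intro has_partial_imp_partial has_partial_lincomb smooth_fun_has_partial) (auto simp: test_fun_def)
  then show ?thesis by (simp add: vec_eq_iff grad_nth scaleR_fun_def)
qed

lemma grad_diff:
  assumes f: "test_fun f" and g: "test_fun g"
  shows "grad (f - g) x = grad f x - grad g x"
proof -
  have "f - g \<in> {f. test_fun f}" using subspace_test_fun f g by (intro subspace_diff) auto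
  then have "grad (f - g + g) x = grad (f - g) x + grad g x" using g by (intro grad_add) auto
  then show ?thesis by simp
qed

lemma energy_integrable:
  "test_fun f \<Longrightarrow> test_fun g \<Longrightarrow> integrable (mu V) (\<lambda>x. grad f x \<bullet> grad g x)"
  by (intro compactly_supported_integrable_mu compactly_supported_grad_inner)

sublocale form_on_core H ip D energy
proof -
  interpret H: semi_inner_space H ip
    using semi_inner_square_integrable unfolding ip_def[abs_def] .
  interpret D: semi_inner_space D energy
  proof
    show "energy f g = energy g f" for f g by (simp add: energy_def inner_commute)
  qed (auto simp: subspace_test_fun energy_def grad_add grad_scaleR inner_add_left energy_integrable)
  show "form_on_core H ip D energy"
  proof unfold_locales
    show "D \<subseteq> H" using test_fun_in_H by auto
    fix x :: "nat \<Rightarrow> real^'n \<Rightarrow> real"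
    assume x: "\<And>n. x n \<in> D"
      and "\<And>d. d > 0 \<Longrightarrow> \<exists>N. \<forall>k\<ge>N. \<forall>m\<ge>N. ip (x k - x m) (x k - x m) < d"
    then have "\<exists>u\<in>H. (\<lambda>n. \<integral>y. (x n y - u y)\<^sup>2 \<partial>mu V) \<longlonglongrightarrow> 0"
      by (intro square_integrable_complete finite_measure_axioms)
        (auto simp: test_fun_in_H ip_def power2_eq_square)
    then show "\<exists>u\<in>H. (\<lambda>n. ip (x n - u) (x n - u)) \<longlonglongrightarrow> 0"
      by (simp add: ip_def power2_eq_square)
  qed
qed

text \<open>With all derivatives on \<open>\<psi>\<close>, the form against a fixed test function is
  continuous in \<open>\<phi>\<close> for the L^2 seminorm. This is what makes the form
  closable.\<close>

lemma Green:
  assumes "test_fun \<phi>" "test_fun \<psi>"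
  shows "energy \<phi> \<psi> = ip \<phi> (- genL V \<psi>)"
proof -
  have L: "compactly_supported (genL V \<psi>)" by (rule compactly_supported_genL[OF smooth_V assms(2)])
  have [measurable]: "genL V \<psi> \<in> borel_measurable borel" "\<phi> \<in> borel_measurable borel"
    "(\<lambda>x. grad \<phi> x \<bullet> grad \<psi> x) \<in> borel_measurable borel"
    using L assms by (auto intro: compactly_supported_borel test_fun_compactly_supported compactly_supported_grad_inner)
  show ?thesis
    using integration_by_parts[OF smooth_V assms]
    by (simp add: energy_def ip_def integral_mu)
qed

lemma form_approx_iff:
  "form_approx V f \<phi> \<longleftrightarrow> (\<forall>k. \<phi> k \<in> D) \<and> (\<lambda>k. ip (\<phi> k - f) (\<phi> k - f)) \<longlonglongrightarrow> 0 \<and>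
     (\<forall>e>0. \<exists>N. \<forall>k\<ge>N. \<forall>m\<ge>N. energy (\<phi> k - \<phi> m) (\<phi> k - \<phi> m) < e)"
proof (cases "\<forall>k. test_fun (\<phi> k)")
  case True
  then show ?thesis
    unfolding form_approx_def power2_norm_eq_inner
    by (simp add: ip_def energy_def grad_diff power2_eq_square)
qed (auto simp: form_approx_def)

text \<open>The weak equation is known along the one sequence \<open>x\<close>, while the graph
  demands it along every form approximation of \<open>u\<close>. By Green's identity the limit
  depends on \<open>u\<close> alone, so the value computed along \<open>x\<close> serves all of
  them.\<close>

lemma solves_friedrichs_graph:
  assumes s: "solves f u x p"
  shows "friedrichs_graph V u (f - u)"
  unfolding friedrichs_graph_def
proof (intro conjI allI impI)
  note mem = solves_mem[OF s]
  have lim: "(\<lambda>n. ip (x n - u) (x n - u)) \<longlonglongrightarrow> 0" using s by (simp add: solves_def)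
  have Cau: "\<exists>N. \<forall>k\<ge>N. \<forall>m\<ge>N. energy (x k - x m) (x k - x m) < d" if "d > 0" for d
  proof -
    have "energy (x k - x m) (x k - x m) \<le> e1 (x k - x m) (x k - x m)" for k m
      by (intro e_le_e1 D.closed mem)
    then show ?thesis using solves_Cauchy[OF s that] le_less_trans by blast
  qed
  then have "form_approx V u x" unfolding form_approx_iff using mem(3) lim by blast
  then show "form_dom V u" unfolding form_dom_def L2mu_iff using mem(2) by blast
  show "L2mu V (f - u)" unfolding L2mu_iff using mem by simp
  fix \<phi> and \<psi> :: "real^'n \<Rightarrow> real"
  assume \<phi>: "form_approx V u \<phi>" and \<psi>: "test_fun \<psi>"
  define h where "h = - genL V \<psi>"
  have h: "h \<in> H"
    using compactly_supported_in_H[OF compactly_supported_genL[OF smooth_V \<psi>]]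
      H.closed(3)[of "genL V \<psi>" "-1"] by (simp add: h_def)
  have weak: "(\<lambda>k. energy (y k) \<psi>) \<longlonglongrightarrow> ip h u"
    if y: "\<And>k. y k \<in> D" and ylim: "(\<lambda>k. ip (y k - u) (y k - u)) \<longlonglongrightarrow> 0" for y
  proof -
    have "(\<lambda>k. ip h (y k)) \<longlonglongrightarrow> ip h u"
      by (intro H.tendsto_right in_H y mem(2) h ylim)
    moreover have "energy (y k) \<psi> = ip h (y k)" for k
      using Green[of "y k" \<psi>] y \<psi> in_H h H.sym[of h "y k"] by (auto simp: h_def)
    ultimately show ?thesis by simp
  qed
  have "(\<lambda>k. e1 (x k) \<psi> - ip \<psi> (x k)) \<longlonglongrightarrow> ip f \<psi> - ip \<psi> u"
    using \<psi> in_H by (intro tendsto_diff solves_tendsto_e1[OF s] solves_tendsto_ip[OF s]) auto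
  then have "(\<lambda>k. energy (x k) \<psi>) \<longlonglongrightarrow> ip (f - u) \<psi>"
    using \<psi> mem in_H by (simp add: e1_def H.diff_left H.sym[of \<psi>])
  then have "ip (f - u) \<psi> = ip h u"
    using weak[OF mem(3) lim] LIMSEQ_unique by blast
  moreover have "(\<lambda>k. energy (\<phi> k) \<psi>) \<longlonglongrightarrow> ip h u"
    using \<phi> unfolding form_approx_iff by (intro weak) auto
  ultimately show "(\<lambda>k. \<integral>x. grad (\<phi> k) x \<bullet> grad \<psi> x \<partial>mu V) \<longlonglongrightarrow> (\<integral>x. (f - u) x * \<psi> x \<partial>mu V)"
    by (simp add: energy_def ip_def)
qed

lemma ess_spec_le_of_essential_level:
  assumes "essential_level c0" "0 < c0"
  obtains lam where "lam \<in> ess_spec V" "lam \<le> 1 / c0 - 1"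
proof -
  obtain c f u where c: "c0 \<le> c" and s: "\<And>n. \<exists>x p. solves (f n) (u n) x p"
    and u1: "\<And>n. ip (u n) (u n) = 1" and wn: "H.weakly_null u"
    and lim: "(\<lambda>n. ip (f n - (1/c) *\<^sub>R u n) (f n - (1/c) *\<^sub>R u n)) \<longlonglongrightarrow> 0"
    by (rule singular_Weyl_sequence[OF assms]) (rule that)
  define lam where "lam = 1 / c - 1"
  have "lam \<in> ess_spec V"
    unfolding ess_spec_def
  proof (intro CollectI exI conjI allI impI)
    show "friedrichs_graph V (u k) (f k - u k)" for k using s solves_friedrichs_graph by blast
    show "(\<integral>x. (u k x)\<^sup>2 \<partial>mu V) = 1" for k using u1 by (simp add: ip_def power2_eq_square)
    show "(\<lambda>k. \<integral>x. u k x * h x \<partial>mu V) \<longlonglongrightarrow> 0" if "L2mu V h" for h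
      using wn that unfolding H.weakly_null_def L2mu_iff ip_def by blast
    \<comment> \<open>With \<open>lam = 1 / c - 1\<close>, subtracting \<open>lam\<close> times
      \<open>u k\<close> from \<open>f k - u k\<close> leaves
      \<open>f k - (1/c) *\<^sub>R u k\<close>.\<close>
    have "(\<integral>x. ((f k - u k) x - lam * u k x)\<^sup>2 \<partial>mu V) = ip (f k - (1/c) *\<^sub>R u k) (f k - (1/c) *\<^sub>R u k)" for k
      by (simp add: ip_def lam_def power2_eq_square algebra_simps)
    then show "(\<lambda>k. \<integral>x. ((f k - u k) x - lam * u k x)\<^sup>2 \<partial>mu V) \<longlonglongrightarrow> 0" using lim by simp
  qed
  moreover have "lam \<le> 1 / c0 - 1" unfolding lam_def using c assms(2) by (simp add: frac_le)
  ultimately show thesis by (rule that)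
qed

section \<open>From a failing inequality to an essential level\<close>

lemma in_H_integrable:
  assumes "f \<in> H" shows "integrable (mu V) f"
proof -
  have "(\<lambda>_. 1) \<in> H" by (simp add: square_integrable_def)
  from integrable_mult_square_integrable[OF assms this] show ?thesis by simp
qed

lemma L1_small_imp_weak_nbhd:
  assumes "finite G" "G \<subseteq> H"
  shows "\<exists>\<delta>>0. \<forall>f\<in>H. ip f f \<le> 1 \<longrightarrow> (\<integral>x. \<bar>f x\<bar> \<partial>mu V) \<le> \<delta> \<longrightarrow> f \<in> weak_nbhd G"
  using assms
proof (induction G rule: finite_induct)
  case empty
  then show ?case by (auto simp: weak_nbhd_def intro: exI[of _ 1])
next
  case (insert g G)
  then obtain d where d: "d > 0" "\<And>f. f \<in> H \<Longrightarrow> ip f f \<le> 1 \<Longrightarrow> (\<integral>x. \<bar>f x\<bar> \<partial>mu V) \<le> d \<Longrightarrow> f \<in> weak_nbhd G"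
    by auto
  have gH: "g \<in> H" using insert by simp
  obtain e where e: "e > 0" "\<And>f. f \<in> H \<Longrightarrow> integrable (mu V) f \<Longrightarrow> (\<integral>x. f x * f x \<partial>mu V) \<le> 1 \<Longrightarrow>
      (\<integral>x. \<bar>f x\<bar> \<partial>mu V) \<le> e \<Longrightarrow> \<bar>\<integral>x. f x * g x \<partial>mu V\<bar> \<le> 1"
    by (rule L1_small_imp_weakly_small[OF gH]) (rule that)
  have "f \<in> weak_nbhd (insert g G)" if "f \<in> H" "ip f f \<le> 1" "(\<integral>x. \<bar>f x\<bar> \<partial>mu V) \<le> min d e" for f
    using d(2)[of f] e(2)[of f] that in_H_integrable[of f] by (simp add: weak_nbhd_def ip_def)
  then show ?case using d(1) e(1) by (intro exI[of _ "min d e"]) auto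
qed

lemma essential_level_of_violation:
  assumes r: "r > 0"
    and viol: "\<And>b. b \<ge> 0 \<Longrightarrow> \<exists>f \<phi> E. form_dom V f \<and> form_approx V f \<phi> \<and>
      (\<lambda>k. \<integral>x. (norm (grad (\<phi> k) x))\<^sup>2 \<partial>mu V) \<longlonglongrightarrow> E \<and>
      r * E + b * (\<integral>x. \<bar>f x\<bar> \<partial>mu V)\<^sup>2 < (\<integral>x. (f x)\<^sup>2 \<partial>mu V)"
  shows "essential_level (1 / (1 + 1 / r))"
  unfolding essential_level_def
proof (intro allI impI)
  fix G assume "finite G" "G \<subseteq> H"
  then obtain \<delta> where \<delta>: "\<delta> > 0" "\<And>f. f \<in> H \<Longrightarrow> ip f f \<le> 1 \<Longrightarrow> (\<integral>x. \<bar>f x\<bar> \<partial>mu V) \<le> \<delta> \<Longrightarrow> f \<in> weak_nbhd G"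
    using L1_small_imp_weak_nbhd[of G] by auto
  \<comment> \<open>The constant \<open>1 / \<delta>\<^sup>2\<close> is chosen so that, once
    \<open>f\<close> is normalised in L^2, the violated inequality puts its L^1 norm below
    \<open>\<delta>\<close>.\<close>
  obtain f \<phi> E where dom: "form_dom V f" and ap: "form_approx V f \<phi>"
    and E: "(\<lambda>k. \<integral>x. (norm (grad (\<phi> k) x))\<^sup>2 \<partial>mu V) \<longlonglongrightarrow> E"
    and v: "r * E + 1 / \<delta>\<^sup>2 * (\<integral>x. \<bar>f x\<bar> \<partial>mu V)\<^sup>2 < (\<integral>x. (f x)\<^sup>2 \<partial>mu V)"
    using viol[of "1 / \<delta>\<^sup>2"] by auto
  have fH: "f \<in> H" using dom by (simp add: form_dom_def L2mu_iff)
  define F where "F = ip f f"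
  define I where "I = (\<integral>x. \<bar>f x\<bar> \<partial>mu V)"
  have v: "r * E + 1 / \<delta>\<^sup>2 * I\<^sup>2 < F" using v by (simp add: F_def I_def ip_def power2_eq_square)
  have En: "(\<lambda>k. energy (\<phi> k) (\<phi> k)) \<longlonglongrightarrow> E" using E by (simp add: energy_def power2_norm_eq_inner)
  have E0: "0 \<le> E"
    by (rule LIMSEQ_le_const[OF En]) (use ap D.nonneg in \<open>auto simp: form_approx_iff\<close>)
  have rE: "0 \<le> r * E" "0 \<le> 1 / \<delta>\<^sup>2 * I\<^sup>2" using r E0 by simp_all
  have F: "F > 0" "r * E < F" "1 / \<delta>\<^sup>2 * I\<^sup>2 < F" using v rE by linarith+
  \<comment> \<open>The violator tests its own resolvent equation; together with
    \<open>r * E < F\<close> this bounds the normalised form from below by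
    \<open>1 / (1 + 1 / r)\<close>.\<close>
  have var: "F\<^sup>2 \<le> ip f (resolvent f) * (E + F)"
    unfolding F_def using ap by (intro resolvent_variational[OF fH _ _ En]) (auto simp: form_approx_iff)
  have "F\<^sup>2 \<le> ip f (resolvent f) * ((1 + 1 / r) * F)"
  proof (rule order_trans[OF var], rule mult_left_mono)
    show "E + F \<le> (1 + 1 / r) * F" using F(2) r by (simp add: field_simps)
  qed (rule T_nonneg[OF fH])
  then have "F * F \<le> (ip f (resolvent f) * (1 + 1 / r)) * F" by (simp add: power2_eq_square algebra_simps)
  then have "F \<le> ip f (resolvent f) * (1 + 1 / r)" using F(1) by (simp only: mult_le_cancel_right_pos)
  then have level: "1 / (1 + 1 / r) \<le> ip f (resolvent f) / F"
    using F(1) r by (simp add: field_simps add_pos_pos)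
  define q where "q = sqrt F"
  have q: "q > 0" "q * q = F" using F(1) by (auto simp: q_def)
  define w where "w = (1 / q) *\<^sub>R f"
  have wH: "w \<in> H" using fH by (simp add: w_def)
  have "w \<in> weak_nbhd G"
  proof (rule \<delta>(2)[OF wH])
    show "ip w w \<le> 1" using fH q by (simp add: w_def H.bilinear F_def[symmetric])
    have "I\<^sup>2 < (\<delta> * q)\<^sup>2" using F(3) \<delta>(1) q(2) by (simp add: field_simps power2_eq_square)
    then have "I < \<delta> * q" using \<delta>(1) q(1) by (intro power2_less_imp_less[of I]) auto
    moreover have "(\<integral>x. \<bar>w x\<bar> \<partial>mu V) = I / q" using q(1) by (simp add: w_def I_def abs_mult)
    ultimately show "(\<integral>x. \<bar>w x\<bar> \<partial>mu V) \<le> \<delta>" using q(1) by (simp add: pos_divide_le_eq)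
  qed
  \<comment> \<open>The factor passes through symmetry, because \<open>resolvent w\<close> need not
    be the same multiple of \<open>resolvent f\<close>.\<close>
  moreover have "ip w (resolvent w) = ip f (resolvent f) / F"
  proof -
    have "ip w (resolvent w) = 1 / q * ip f (resolvent w)"
      unfolding w_def using fH by (intro H.scale_left T_closed H.closed) auto
    also have "ip f (resolvent w) = ip (resolvent f) w" by (rule T_sym[OF fH wH, symmetric])
    also have "\<dots> = 1 / q * ip (resolvent f) f" unfolding w_def using fH by (simp add: H.scale_right)
    also have "ip (resolvent f) f = ip f (resolvent f)" by (rule T_sym[OF fH fH])
    finally show ?thesis using q by (simp add: field_simps)
  qed
  ultimately show "\<exists>w\<in>weak_nbhd G. 1 / (1 + 1 / r) \<le> ip w (resolvent w)" using level by (intro bexI[of _ w]) simp_all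
qed

end

text \<open>\<open>E\<close> is the value of the closed Dirichlet form at \<open>f\<close>, read off
  as the limit of energies along the approximating sequence.\<close>

theorem theorem4p1:
  fixes V :: "real^'n \<Rightarrow> real" and r0 :: real
  assumes "smooth_fun V"
    and "integrable lborel (\<lambda>x. exp (- V x))"
    and "r0 \<ge> 0"
    and "\<forall>lam\<in>ess_spec V. r0 > 0 \<and> 1 / r0 \<le> lam"
  shows "\<exists>\<beta>::real \<Rightarrow> real. \<forall>r > 8 * r0. \<beta> r \<ge> 0 \<and>
     (\<forall>f \<phi> E. form_dom V f \<longrightarrow> form_approx V f \<phi> \<longrightarrow>
        (\<lambda>k. \<integral>x. (norm (grad (\<phi> k) x))^2 \<partial>mu V) \<longlonglongrightarrow> E \<longrightarrow>
        (\<integral>x. (f x)^2 \<partial>mu V) \<le> r * E + \<beta> r * (\<integral>x. \<bar>f x\<bar> \<partial>mu V)^2)"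
proof -
  interpret smooth_potential V using assms(1,2) by unfold_locales
  have "\<exists>b\<ge>0. \<forall>f \<phi> E. form_dom V f \<longrightarrow> form_approx V f \<phi> \<longrightarrow>
        (\<lambda>k. \<integral>x. (norm (grad (\<phi> k) x))^2 \<partial>mu V) \<longlonglongrightarrow> E \<longrightarrow>
        (\<integral>x. (f x)^2 \<partial>mu V) \<le> r * E + b * (\<integral>x. \<bar>f x\<bar> \<partial>mu V)^2" if r: "r > 8 * r0" for r
  proof (rule ccontr)
    assume neg: "\<not> ?thesis"
    have r0: "r > 0" "r > r0" using r assms(3) by simp_all
    have "essential_level (1 / (1 + 1 / r))"
    proof (rule essential_level_of_violation[OF r0(1)])
      fix b :: real assume "b \<ge> 0"
      with neg show "\<exists>f \<phi> E. form_dom V f \<and> form_approx V f \<phi> \<and>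
        (\<lambda>k. \<integral>x. (norm (grad (\<phi> k) x))\<^sup>2 \<partial>mu V) \<longlonglongrightarrow> E \<and>
        r * E + b * (\<integral>x. \<bar>f x\<bar> \<partial>mu V)\<^sup>2 < (\<integral>x. (f x)\<^sup>2 \<partial>mu V)"
        by (meson not_le)
    qed
    moreover have "0 < 1 / (1 + 1 / r)" using r0 by (simp add: add_pos_pos)
    ultimately obtain lam where lam: "lam \<in> ess_spec V" "lam \<le> 1 / (1 / (1 + 1 / r)) - 1"
      by (rule ess_spec_le_of_essential_level)
    \<comment> \<open>The bound on \<open>lam\<close> simplifies to \<open>1 / r\<close>. For
      \<open>r0 = 0\<close> the mere existence of \<open>lam\<close> contradicts the hypothesis,
      whose conjunct \<open>r0 > 0\<close> guards against \<open>1 / 0 = 0\<close>; otherwise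
      \<open>1 / r0 \<le> 1 / r\<close> contradicts \<open>r > r0\<close>.\<close>
    have "r0 > 0" "1 / r0 \<le> 1 / r" using assms(4) lam by force+
    then show False using r0 by (simp add: field_simps)
  qed
  \<comment> \<open>A constant is chosen for each \<open>r\<close> separately; at
    \<open>r \<le> 8 * r0\<close> the value of \<open>\<beta>\<close> is arbitrary.\<close>
  then show ?thesis by metis
qed

end
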